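(* Let $a>0$, $\sigma>1$, $\nu>0$, and let $u^0\in Z^{-1}_{a,\sigma}(\mathbb R^3)$ be divergence free. Then there exist a time $T>0$ and a unique solution $u\in\mathcal C([0,T],Z^{-1}_{a,\sigma}(\mathbb R^3))\cap L^1([0,T],Z^{1}_{a,\sigma}(\mathbb R^3))$ of (NSE) on $[0,T]$ with initial data $u^0$.
   Context: (NSE) denotes the 3D incompressible Navier–Stokes system $\partial_t u-\nu\Delta u+u\cdot\nabla u=-\nabla p$, $\operatorname{div}u=0$ on $\mathbb R^3$, $u(0,x)=u^0(x)$, with viscosity $\nu>0$; solutions are understood in the integral (mild) form $u(t)=e^{\nu t\Delta}u^0-\int_0^te^{\nu(t-\tau)\Delta}(u\cdot\nabla u)(\tau)\,d\tau$ (pressure eliminated). The Fourier transform is $\hat f(\xi)=\int_{\mathbb R^3}e^{-ix\cdot\xi}f(x)\,dx$. For $a>0$, $\sigma>1$, $\rho\in\mathbb R$, $Z^{\rho}_{a,\sigma}(\mathbb R^3)$ is the set of $f\in\mathcal S'(\mathbb R^3)$ with $\|f\|_{Z^{\rho}_{a,\sigma}}=\int_{\mathbb R^3}|\xi|^{\rho}e^{a|\xi|^{1/\sigma}}|\hat f(\xi)|\,d\xi<\infty$.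
   Formalization: The integral form of (NSE) is taken with the Leray projector applied to u·∇u, which eliminating the pressure requires; without it the formula is incompatible with div u = 0. *)

theory Defs
  imports "HOL-Analysis.Analysis"
begin

text \<open>Everything is formulated on the Fourier side: a (vector) distribution u in
  Z^rho_{a,sigma}(R^3)^3 is identified with its Fourier transform, a measurable function
  R^3 -> C^3 (determined up to a.e. equality).  Convention: hat f(xi) = int e^{-i x.xi} f(x) dx.\<close>

definition zweight :: "real \<Rightarrow> real \<Rightarrow> real \<Rightarrow> real^3 \<Rightarrow> real" where
  "zweight \<rho> a \<sigma> \<xi> = norm \<xi> powr \<rho> * exp (a * norm \<xi> powr (1 / \<sigma>))"

definition Znorm :: "real \<Rightarrow> real \<Rightarrow> real \<Rightarrow> (real^3 \<Rightarrow> complex^3) \<Rightarrow> ennreal" where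
  "Znorm \<rho> a \<sigma> f = (\<integral>\<^sup>+ \<xi>. ennreal (zweight \<rho> a \<sigma> \<xi> * norm (f \<xi>)) \<partial>lborel)"

definition Zspace :: "real \<Rightarrow> real \<Rightarrow> real \<Rightarrow> (real^3 \<Rightarrow> complex^3) set" where
  "Zspace \<rho> a \<sigma> = {f. f \<in> borel_measurable lborel \<and> Znorm \<rho> a \<sigma> f < \<infinity>}"

definition leray :: "real^3 \<Rightarrow> complex^3 \<Rightarrow> complex^3" where
  "leray \<xi> w = (\<chi> k. w $ k - ((\<Sum>j\<in>UNIV. complex_of_real (\<xi> $ j) * w $ j)
                  / complex_of_real ((norm \<xi>)\<^sup>2)) * complex_of_real (\<xi> $ k))"

text \<open>Integrand of the Fourier transform of u.grad u (before division by (2 pi)^3):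
  (u_j d_j u_k)^(xi) = (2 pi)^(-3) sum_j int hat u_j(xi - eta) (i eta_j) hat u_k(eta) d eta.\<close>
definition nonlin_integrand :: "(real^3 \<Rightarrow> complex^3) \<Rightarrow> real^3 \<Rightarrow> real^3 \<Rightarrow> complex^3" where
  "nonlin_integrand w \<xi> \<eta> =
     (\<chi> k. (\<Sum>j\<in>UNIV. w (\<xi> - \<eta>) $ j * (\<i> * complex_of_real (\<eta> $ j)) * w \<eta> $ k))"

definition duhamel_integrand ::
  "real \<Rightarrow> (real \<Rightarrow> real^3 \<Rightarrow> complex^3) \<Rightarrow> real \<Rightarrow> real^3 \<Rightarrow> real \<times> (real^3) \<Rightarrow> complex^3" where
  "duhamel_integrand \<nu> v t \<xi> p =
     (exp (- \<nu> * (t - fst p) * (norm \<xi>)\<^sup>2) / (2 * pi) ^ 3)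
       *\<^sub>R leray \<xi> (nonlin_integrand (v (fst p)) \<xi> (snd p))"

definition NS_mild_solution ::
  "real \<Rightarrow> real \<Rightarrow> real \<Rightarrow> real \<Rightarrow> (real^3 \<Rightarrow> complex^3) \<Rightarrow> (real \<Rightarrow> real^3 \<Rightarrow> complex^3) \<Rightarrow> bool" where
  "NS_mild_solution \<nu> a \<sigma> T u0 v \<longleftrightarrow>
     (\<forall>t\<in>{0..T}. v t \<in> Zspace (-1) a \<sigma>) \<and>
     (\<forall>t\<in>{0..T}. ((\<lambda>s. Znorm (-1) a \<sigma> (\<lambda>\<xi>. v s \<xi> - v t \<xi>)) \<longlongrightarrow> 0) (at t within {0..T})) \<and>
     (\<integral>\<^sup>+ t\<in>{0..T}. Znorm 1 a \<sigma> (v t) \<partial>lborel) < \<infinity> \<and>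
     (\<forall>t\<in>{0..T}. AE \<xi> in lborel.
        set_integrable lborel ({0..t} \<times> UNIV) (duhamel_integrand \<nu> v t \<xi>) \<and>
        v t \<xi> = exp (- \<nu> * t * (norm \<xi>)\<^sup>2) *\<^sub>R u0 \<xi>
                 - (LINT p : {0..t} \<times> UNIV | lborel. duhamel_integrand \<nu> v t \<xi> p))"

end

theory Submission
  imports Defs
begin

text \<open>The Leray projection makes every solution of the Duhamel equation divergence free, so the factor
  \<open>\<eta>\<close> in the nonlinearity may be traded for \<open>\<xi>\<close>; the weight \<open>e\<^bsup>a|\<xi>|^(1/\<sigma>)\<^esup>\<close> is submultiplicative.
  Hence the Duhamel term is controlled in \<open>L\<^sup>\<infinity>Z\<^sup>-\<^sup>1 \<inter> L\<^sup>1Z\<^sup>1\<close> by \<open>\<integral>\<parallel>u\<parallel>\<^sup>2\<close> in \<open>Z\<^sup>0\<close>, and by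
  interpolation (Cauchy--Schwarz) in \<open>L\<^sup>2Z\<^sup>0\<close>, where the heat flow of the data is small for short time.
  Existence: the scalar Picard iteration for the norms is monotone and bounded in \<open>L\<^sup>2Z\<^sup>0\<close>; its limit
  is finite almost everywhere and majorises, increment by increment, the vector-valued Picard iteration,
  which therefore converges pointwise and dominatedly. Uniqueness: the \<open>L\<^sup>2Z\<^sup>0\<close> estimate for the
  difference of two solutions closes on time intervals where their \<open>L\<^sup>2Z\<^sup>0\<close> norms are small, and
  finitely many such intervals cover \<open>[0,T]\<close>.\<close>

subsection \<open>Measure-theoretic preliminaries\<close>

text \<open>The space Z^-1 is scale invariant up to the exponential weight, so smallness is not
  taken from the size of the norm: it comes from absolute continuity of a time integral, and the
  existence time depends on the profile of \<open>u0\<close>. The obstacle that shapes the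
  development is the order of quantifiers. A mild solution satisfies its equation for each t outside
  a null set of frequencies that may depend on t, whereas Tonelli and dominated convergence call for
  joint measurability and one null set for all times. The predicate \<open>fixpoint\<close> has this
  stronger form: existence is proved for it, uniqueness within it, and every mild solution is shown
  to agree with such a fixed point at each time. Norm estimates are carried out for
  \<open>ennreal\<close>-valued functions of time and frequency, where Tonelli asks for
  measurability only and a diverging integral is merely an infinite bound.\<close>

lemma lborel_distr_diff:
  fixes c :: "'a::euclidean_space"
  shows "distr lborel borel (\<lambda>x. c - x) = lborel"
  using lborel_affine[of "-1" c] by (simp add: density_1)

lemma nn_integral_lborel_minus_const:
  fixes f :: "'a::euclidean_space \<Rightarrow> ennreal"
  assumes [measurable]: "f \<in> borel_measurable borel"
  shows "(\<integral>\<^sup>+x. f (x - c) \<partial>lborel) = (\<integral>\<^sup>+x. f x \<partial>lborel)"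
  by (subst (2) lborel_distr_plus[of "-c", symmetric]) (simp add: nn_integral_distr)

lemma AE_lborel_diff:
  fixes c :: "'a::euclidean_space"
  assumes "AE x in lborel. P x"
  shows "AE x in lborel. P (c - x)"
proof (rule AE_distrD[where M' = borel and f = "\<lambda>x. c - x"])
  show "AE x in distr lborel borel (\<lambda>x. c - x). P x"
    by (subst lborel_distr_diff) (rule assms)
qed simp

lemma nn_integral_lborel_pair:
  fixes f :: "'a::euclidean_space \<Rightarrow> 'b::euclidean_space \<Rightarrow> ennreal"
  assumes "case_prod f \<in> borel_measurable (borel \<Otimes>\<^sub>M borel)"
  shows "(\<integral>\<^sup>+p. f (fst p) (snd p) \<partial>lborel) = (\<integral>\<^sup>+x. \<integral>\<^sup>+y. f x y \<partial>lborel \<partial>lborel)"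
proof -
  have "case_prod f \<in> borel_measurable (lborel \<Otimes>\<^sub>M lborel)"
    using assms by (simp add: lborel_prod borel_prod)
  from lborel.nn_integral_fst[OF this] show ?thesis
    by (simp add: lborel_prod case_prod_beta')
qed

lemma nn_integral_lborel_commute:
  fixes f :: "'a::euclidean_space \<Rightarrow> 'b::euclidean_space \<Rightarrow> ennreal"
  assumes "case_prod f \<in> borel_measurable (borel \<Otimes>\<^sub>M borel)"
  shows "(\<integral>\<^sup>+x. \<integral>\<^sup>+y. f x y \<partial>lborel \<partial>lborel) = (\<integral>\<^sup>+y. \<integral>\<^sup>+x. f x y \<partial>lborel \<partial>lborel)"
proof (rule lborel_pair.Fubini'[symmetric])
  show "case_prod f \<in> borel_measurable (lborel \<Otimes>\<^sub>M lborel)"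
    using assms by (simp add: lborel_prod borel_prod)
qed

lemma AE_lborel_pairI:
  fixes P :: "'a::euclidean_space \<times> 'b::euclidean_space \<Rightarrow> bool"
  assumes "Measurable.pred (borel \<Otimes>\<^sub>M borel) P"
    and "AE x in lborel. AE y in lborel. P (x, y)"
  shows "AE p in lborel. P p"
proof -
  have "AE p in lborel \<Otimes>\<^sub>M lborel. P p"
    using assms sets_pair_measure_cong[OF sets_lborel sets_lborel]
    by (intro lborel_pair.AE_pair_measure) (auto simp: pred_def space_pair_measure)
  then show ?thesis unfolding lborel_prod .
qed

text \<open>\<open>P\<close> may fail to be measurable: its exceptional set is enlarged to a Borel
  null set, and the cylinder over that set is null by Tonelli.\<close>

lemma AE_lborel_snd:
  fixes P :: "'b::euclidean_space \<Rightarrow> bool"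
  assumes "AE y in lborel. P y"
  shows "AE p in (lborel :: ('a::euclidean_space \<times> 'b) measure). P (snd p)"
proof -
  from assms obtain N where N: "{y. \<not> P y} \<subseteq> N" "emeasure lborel N = 0" "N \<in> sets borel"
    by (auto elim!: AE_E)
  have "AE p in (lborel :: ('a \<times> 'b) measure). snd p \<notin> N"
  proof (rule AE_lborel_pairI)
    show "Measurable.pred (borel \<Otimes>\<^sub>M borel) (\<lambda>p::'a \<times> 'b. snd p \<notin> N)"
      using N(3) by measurable
    show "AE x in lborel. AE y in lborel. snd (x :: 'a, y) \<notin> N"
      using N by (simp add: AE_not_in null_setsI)
  qed
  then show ?thesis
    by eventually_elim (use N(1) in auto)
qed

lemma measurable_vec_nth_compose [measurable (raw)]:
  fixes f :: "'a \<Rightarrow> 'b::{real_normed_vector, second_countable_topology} ^ 'n"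
  assumes "f \<in> borel_measurable M"
  shows "(\<lambda>x. f x $ i) \<in> borel_measurable M"
proof (rule measurable_compose[OF assms])
  show "(\<lambda>x::'b^'n. x $ i) \<in> borel_measurable borel"
    by (intro borel_measurable_continuous_onI continuous_intros)
qed

lemma borel_measurable_complex_vec:
  fixes f :: "'a \<Rightarrow> complex^'n"
  assumes "\<And>i. (\<lambda>x. f x $ i) \<in> borel_measurable M"
  shows "f \<in> borel_measurable M"
proof (subst borel_measurable_euclidean_space, safe)
  fix b :: "complex^'n" assume "b \<in> Basis"
  then obtain i u where "b = axis i u" by (auto simp: Basis_vec_def)
  then show "(\<lambda>x. f x \<bullet> b) \<in> borel_measurable M"
    using assms[of i] by (simp add: inner_axis borel_measurable_inner)
qed

text \<open>The increments of \<open>v\<close> are dominated by those of \<open>m\<close>, whose sum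
  telescopes to at most the supremum; hence they are absolutely summable. Finiteness of the supremum
  allows the passage to real numbers.\<close>

lemma convergent_if_dominated_by_ennreal_seq:
  fixes v :: "nat \<Rightarrow> 'a::banach" and m :: "nat \<Rightarrow> ennreal"
  assumes step: "\<And>n. ennreal (norm (v (Suc n) - v n)) + m n \<le> m (Suc n)"
    and fin: "(SUP n. m n) < \<infinity>"
  shows "convergent v"
proof -
  have up: "m n \<le> (SUP n. m n)" for n by (rule SUP_upper) simp
  have mfin: "m n < top" for n using up[of n] fin by (auto simp: order.strict_trans1)
  define r where "r n = enn2real (m n)" for n
  have r: "m n = ennreal (r n)" "r n \<ge> 0" for n
    using mfin[of n] by (auto simp: r_def)
  have rs: "norm (v (Suc n) - v n) + r n \<le> r (Suc n)" for n
    using step[of n] r by (simp flip: ennreal_plus)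
  have "summable (\<lambda>n. norm (v (Suc n) - v n))"
  proof (rule bounded_imp_summable)
    fix n
    have "(\<Sum>k\<le>n. norm (v (Suc k) - v k)) \<le> (\<Sum>k\<le>n. r (Suc k) - r k)"
      using rs by (intro sum_mono) (simp add: le_diff_eq)
    also have "\<dots> = r (Suc n) - r 0"
      by (induction n) auto
    also have "\<dots> \<le> enn2real (SUP n. m n)"
      using r(2)[of 0] enn2real_mono[OF up[of "Suc n"] fin[unfolded infinity_ennreal_def]]
      unfolding r_def by linarith
    finally show "(\<Sum>k\<le>n. norm (v (Suc k) - v k)) \<le> enn2real (SUP n. m n)" .
  qed simp
  then have "summable (\<lambda>n. v (Suc n) - v n)" by (rule summable_norm_cancel)
  then have "convergent (\<lambda>n. \<Sum>k<n. v (Suc k) - v k)"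
    by (simp add: summable_iff_convergent)
  then have "convergent (\<lambda>n. (v n - v 0) + v 0)"
    by (intro convergent_add) (simp_all add: sum_lessThan_telescope convergent_const)
  then show ?thesis by simp
qed

text \<open>By homogeneity only x + y = 1 matters, and z \<le> z powr p for 0 \<le> z \<le> 1 and p
  \<le> 1.\<close>

lemma powr_add_le_add_powr:
  fixes x y p :: real
  assumes "0 \<le> x" "0 \<le> y" "0 < p" "p \<le> 1"
  shows "(x + y) powr p \<le> x powr p + y powr p"
proof (cases "x + y = 0")
  case True
  then show ?thesis using assms by simp
next
  case False
  define s where "s = x + y"
  have s: "s > 0" using False assms by (simp add: s_def)
  have le: "z / s \<le> (z / s) powr p" if "0 \<le> z" "z \<le> s" for z
    using powr_mono'[of p 1 "z / s"] that s assms by simp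
  have "1 = x / s + y / s" using s by (simp add: s_def flip: add_divide_distrib)
  also have "\<dots> \<le> (x / s) powr p + (y / s) powr p"
    using assms by (intro add_mono le) (auto simp: s_def)
  also have "\<dots> = (x powr p + y powr p) / s powr p"
    using assms s by (simp add: powr_divide add_divide_distrib)
  finally show ?thesis using s by (simp add: s_def field_simps)
qed

text \<open>Absolute continuity of the integral, uniform in the position of the interval.
  \<open>F\<close> is split into its truncation at height n and the excess: the excess has small
  total integral for large n by dominated convergence, and the truncation contributes at most n
  times the length.\<close>

lemma nn_integral_small_on_short_intervals:
  fixes f :: "real \<Rightarrow> ennreal"
  assumes [measurable]: "f \<in> borel_measurable borel"
    and fin: "(\<integral>\<^sup>+t\<in>{0..T}. f t \<partial>lborel) < \<infinity>" and "\<epsilon> > 0"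
  shows "\<exists>\<delta>>0. \<forall>x y. 0 \<le> x \<and> x \<le> y \<and> y \<le> T \<and> y - x \<le> \<delta>
            \<longrightarrow> (\<integral>\<^sup>+t\<in>{x..y}. f t \<partial>lborel) < ennreal \<epsilon>"
proof -
  define F where "F t = f t * indicator {0..T} t" for t
  have [measurable]: "F \<in> borel_measurable borel" unfolding F_def by measurable
  have Ffin: "(\<integral>\<^sup>+t. F t \<partial>lborel) < \<infinity>" using fin by (simp add: F_def)
  have "(\<lambda>n. \<integral>\<^sup>+t. F t - min (F t) (of_nat n) \<partial>lborel) \<longlonglongrightarrow> (\<integral>\<^sup>+t. 0 \<partial>(lborel::real measure))"
  proof (rule nn_integral_dominated_convergence[where w = F])
    have "AE t in lborel. F t \<noteq> \<infinity>"
      using Ffin by (intro nn_integral_PInf_AE) auto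
    then show "AE t in lborel. (\<lambda>n. F t - min (F t) (of_nat n)) \<longlonglongrightarrow> 0"
    proof eventually_elim
      case (elim t)
      then obtain r where r: "F t = ennreal r" "r \<ge> 0" by (cases "F t") auto
      have "\<forall>\<^sub>F n in sequentially. F t - min (F t) (of_nat n) = 0"
        using eventually_ge_at_top[of "nat \<lceil>r\<rceil>"]
      proof eventually_elim
        case (elim n)
        then have "r \<le> real n" by linarith
        then have "F t \<le> of_nat n" using r by (simp add: ennreal_of_nat_eq_real_of_nat)
        then show ?case using r by (simp add: min_absorb1)
      qed
      then show ?case by (rule tendsto_eventually)
    qed
  qed (use Ffin in \<open>auto intro!: AE_I2 diff_le_self_ennreal\<close>)
  then have "\<forall>\<^sub>F n in sequentially. (\<integral>\<^sup>+t. F t - min (F t) (of_nat n) \<partial>lborel) < ennreal (\<epsilon> / 2)"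
    using \<open>\<epsilon> > 0\<close> by (intro order_tendstoD(2)) auto
  then obtain n where n: "(\<integral>\<^sup>+t. F t - min (F t) (of_nat n) \<partial>lborel) < ennreal (\<epsilon> / 2)"
    by (auto simp: eventually_sequentially)
  \<comment> \<open>Half of \<epsilon> is left for the truncated part, at most n * \<delta>; the
    added 1 keeps the denominator positive when n = 0.\<close>
  define \<delta> where "\<delta> = \<epsilon> / (2 * (real n + 1))"
  have "\<delta> > 0" using \<open>\<epsilon> > 0\<close> by (simp add: \<delta>_def)
  moreover have "(\<integral>\<^sup>+t\<in>{x..y}. f t \<partial>lborel) < ennreal \<epsilon>"
    if xy: "0 \<le> x" "x \<le> y" "y \<le> T" "y - x \<le> \<delta>" for x y
  proof -
    have "(\<integral>\<^sup>+t\<in>{x..y}. f t \<partial>lborel) \<le> (\<integral>\<^sup>+t. (F t - min (F t) (of_nat n)) + of_nat n * indicator {x..y} t \<partial>lborel)"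
    proof (rule nn_integral_mono)
      fix t
      have "F t \<le> (F t - min (F t) (of_nat n)) + of_nat n"
        by (cases "F t \<le> of_nat n") (auto simp: min_def diff_add_cancel_ennreal intro: add_increasing)
      then show "f t * indicator {x..y} t \<le> (F t - min (F t) (of_nat n)) + of_nat n * indicator {x..y} t"
        using xy by (auto simp: F_def split: split_indicator)
    qed
    also have "\<dots> = (\<integral>\<^sup>+t. F t - min (F t) (of_nat n) \<partial>lborel) + of_nat n * ennreal (y - x)"
      using xy by (simp add: nn_integral_add nn_integral_cmult)
    also have "of_nat n * ennreal (y - x) \<le> ennreal (\<epsilon> / 2)"
    proof -
      have "real n * (y - x) \<le> real n * \<delta>" using xy by (intro mult_left_mono) auto
      also have "\<dots> \<le> \<epsilon> / 2" using \<open>\<epsilon> > 0\<close> by (simp add: \<delta>_def field_simps)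
      finally have "real n * (y - x) \<le> \<epsilon> / 2" .
      from ennreal_leI[OF this] show ?thesis using xy
        by (simp add: ennreal_of_nat_eq_real_of_nat flip: ennreal_mult)
    qed
    finally have "(\<integral>\<^sup>+t\<in>{x..y}. f t \<partial>lborel) \<le> (\<integral>\<^sup>+t. F t - min (F t) (of_nat n) \<partial>lborel) + ennreal (\<epsilon> / 2)"
      by (simp add: add_left_mono)
    also have "\<dots> < ennreal (\<epsilon> / 2) + ennreal (\<epsilon> / 2)"
      using n by (simp add: ennreal_add_left_cancel_less add.commute)
    also have "\<dots> = ennreal \<epsilon>" using \<open>\<epsilon> > 0\<close> by (simp flip: ennreal_plus)
    finally show ?thesis .
  qed
  ultimately show ?thesis by blast
qed

text \<open>The factor r^2 cancels the decay rate \<nu> r^2 up to 1/\<nu>, so the bound is uniform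
  in the frequency r. This gain of two powers is what leads from Z^-1 to Z^1.\<close>

lemma nn_integral_heat_kernel_le:
  assumes "\<nu> > 0"
  shows "(\<integral>\<^sup>+t. ennreal (exp (- \<nu> * (t - s) * r\<^sup>2) * r\<^sup>2) * indicator {s..} t \<partial>lborel) \<le> ennreal (1 / \<nu>)"
proof (cases "r = 0")
  case False
  have "(\<integral>\<^sup>+t. ennreal (exp (- \<nu> * (t - s) * r\<^sup>2) * r\<^sup>2) * indicator {s..} t \<partial>lborel)
    = ennreal (0 - - exp (- \<nu> * (s - s) * r\<^sup>2) / \<nu>)"
  proof (rule nn_integral_FTC_atLeast[where F = "\<lambda>t. - exp (- \<nu> * (t - s) * r\<^sup>2) / \<nu>"])
    show "((\<lambda>t. - exp (- \<nu> * (t - s) * r\<^sup>2) / \<nu>) \<longlongrightarrow> 0) at_top"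
    proof -
      have "\<nu> * r\<^sup>2 > 0" using assms False by simp
      moreover have "filterlim (\<lambda>t. t - s) at_top at_top"
        using filterlim_tendsto_add_at_top[OF tendsto_const[of "-s"] filterlim_ident] by simp
      ultimately have "filterlim (\<lambda>t. (\<nu> * r\<^sup>2) * (t - s)) at_top at_top"
        by (intro filterlim_tendsto_pos_mult_at_top[OF tendsto_const])
      then have "filterlim (\<lambda>t. - ((\<nu> * r\<^sup>2) * (t - s))) at_bot at_top"
        by (simp add: filterlim_uminus_at_bot)
      from filterlim_compose[OF exp_at_bot this]
      have "((\<lambda>t. exp (- ((\<nu> * r\<^sup>2) * (t - s)))) \<longlongrightarrow> 0) at_top" .
      from tendsto_divide_zero[OF tendsto_minus[OF this, simplified], of \<nu>]
      show ?thesis by (simp add: mult_ac)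
    qed
  qed (use assms in \<open>auto intro!: derivative_eq_intros\<close>)
  then show ?thesis by simp
qed simp

text \<open>If \<open>h\<close> vanishes at x, Cauchy-Schwarz on {x..y} and \<open>est\<close> bound
  (h y)^2 by K times the integral of g^2 over {x..y} times (h y)^2. Where the factor is at most 1/2
  this forces h y = 0, and finitely many steps of length at most \<delta> reach T.\<close>

lemma gronwall_ennreal:
  fixes D g :: "real \<Rightarrow> ennreal"
  assumes [measurable]: "D \<in> borel_measurable borel" "g \<in> borel_measurable borel"
    and "T \<ge> 0" and "K > 0"
    and g2: "(\<integral>\<^sup>+t\<in>{0..T}. (g t)\<^sup>2 \<partial>lborel) < \<infinity>"
    and Dg: "\<And>t. D t \<le> g t"
    and est: "\<And>\<tau>. 0 \<le> \<tau> \<Longrightarrow> \<tau> \<le> T \<Longrightarrow>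
       (\<integral>\<^sup>+t\<in>{0..\<tau>}. (D t)\<^sup>2 \<partial>lborel) \<le> ennreal K * (\<integral>\<^sup>+t\<in>{0..\<tau>}. g t * D t \<partial>lborel)\<^sup>2"
  shows "(\<integral>\<^sup>+t\<in>{0..T}. g t * D t \<partial>lborel) = 0"
proof -
  have ind2: "(indicator A t :: ennreal)\<^sup>2 = indicator A t" for A and t :: real
    by (simp add: indicator_def)
  define h where "h \<tau> = (\<integral>\<^sup>+t\<in>{0..\<tau>}. g t * D t \<partial>lborel)" for \<tau>
  \<comment> \<open>The bound of \<open>D\<close> by \<open>g\<close> supplies the finiteness
    without which the absorption below would be void: infinity also satisfies x \<le> x / 2.\<close>
  have hfin: "h \<tau> < \<infinity>" if "\<tau> \<le> T" for \<tau>
  proof -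
    have "h \<tau> \<le> (\<integral>\<^sup>+t\<in>{0..T}. (g t)\<^sup>2 \<partial>lborel)"
      unfolding h_def using that Dg
      by (intro nn_integral_mono) (auto simp: power2_eq_square mult_left_mono split: split_indicator)
    then show ?thesis using g2 by (rule order.strict_trans1)
  qed
  have "1 / (2 * K) > 0" using \<open>K > 0\<close> by simp
  from nn_integral_small_on_short_intervals[OF _ g2 this]
  obtain \<delta> where "\<delta> > 0" and \<delta>: "\<And>x y. 0 \<le> x \<Longrightarrow> x \<le> y \<Longrightarrow> y \<le> T \<Longrightarrow> y - x \<le> \<delta>
      \<Longrightarrow> (\<integral>\<^sup>+t\<in>{x..y}. (g t)\<^sup>2 \<partial>lborel) < ennreal (1 / (2 * K))"
    by auto
  have step: "h y = 0" if "h x = 0" "0 \<le> x" "x \<le> y" "y \<le> T" "y - x \<le> \<delta>" for x y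
  proof -
    have ae: "AE t in lborel. g t * D t * indicator {0..x} t = 0"
      using \<open>h x = 0\<close> unfolding h_def by (simp add: nn_integral_0_iff_AE)
    \<comment> \<open>The product vanishes almost everywhere up to x, so \<open>g\<close> may be cut
      off to {x..y} while \<open>D\<close> keeps all of {0..y}, the range that \<open>est\<close>
      controls.\<close>
    have "h y = (\<integral>\<^sup>+t. (g t * indicator {x..y} t) * (D t * indicator {0..y} t) \<partial>lborel)"
      unfolding h_def
    proof (rule nn_integral_cong_AE, use ae in eventually_elim)
      case (elim t)
      then show ?case using \<open>0 \<le> x\<close> \<open>x \<le> y\<close>
        by (cases "t \<le> x") (simp_all add: indicator_def, blast)
    qed
    then have "(h y)\<^sup>2 \<le> (\<integral>\<^sup>+t. (g t * indicator {x..y} t)\<^sup>2 \<partial>lborel) * (\<integral>\<^sup>+t. (D t * indicator {0..y} t)\<^sup>2 \<partial>lborel)"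
      by (simp only:) (rule Cauchy_Schwarz_nn_integral; measurable)
    also have "\<dots> = (\<integral>\<^sup>+t\<in>{x..y}. (g t)\<^sup>2 \<partial>lborel) * (\<integral>\<^sup>+t\<in>{0..y}. (D t)\<^sup>2 \<partial>lborel)"
      by (simp only: power_mult_distrib ind2)
    also have "\<dots> \<le> ennreal (1 / (2 * K)) * (ennreal K * (h y)\<^sup>2)"
      using \<delta>[of x y] est[of y] that by (intro mult_mono) (auto simp: h_def)
    also have "\<dots> = ennreal (1 / 2) * (h y)\<^sup>2"
      using \<open>K > 0\<close> by (subst mult.assoc[symmetric], subst ennreal_mult[symmetric]) auto
    finally have le: "(h y)\<^sup>2 \<le> ennreal (1 / 2) * (h y)\<^sup>2" .
    obtain r where r: "h y = ennreal r" "r \<ge> 0" using hfin[OF \<open>y \<le> T\<close>] by (cases "h y") auto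
    have "ennreal (r\<^sup>2) \<le> ennreal (1 / 2 * r\<^sup>2)"
      using le r by (subst ennreal_mult) (auto simp: ennreal_power)
    then have "r\<^sup>2 \<le> 1 / 2 * r\<^sup>2" by (subst (asm) ennreal_le_iff) auto
    then have "r = 0" using zero_le_power2[of r] by simp
    then show ?thesis using r by simp
  qed
  have "h (min T (real n * \<delta>)) = 0" for n
  proof (induction n)
    case 0
    have "AE t in lborel. t \<noteq> (0::real)" by (rule AE_lborel_singleton)
    then have "AE t in lborel. g t * D t * indicator {0..0} t = 0"
      by eventually_elim simp
    then have "h 0 = 0" unfolding h_def by (simp add: nn_integral_0_iff_AE)
    then show ?case using \<open>T \<ge> 0\<close> by simp
  next
    case (Suc n)
    show ?case
    proof (rule step[OF Suc])
      have "real (Suc n) * \<delta> = real n * \<delta> + \<delta>" by (simp add: algebra_simps)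
      then show "min T (real n * \<delta>) \<le> min T (real (Suc n) * \<delta>)"
        "min T (real (Suc n) * \<delta>) - min T (real n * \<delta>) \<le> \<delta>"
        using \<open>\<delta> > 0\<close> by linarith+
    qed (use \<open>T \<ge> 0\<close> \<open>\<delta> > 0\<close> in auto)
  qed
  moreover obtain n where "T \<le> real n * \<delta>"
    using ex_less_of_nat_mult[OF \<open>\<delta> > 0\<close>, of T] by (auto intro: less_imp_le)
  ultimately have "h T = 0" by (metis min_def)
  then show ?thesis by (simp add: h_def)
qed

subsection \<open>Weighted norms and the heat semigroup\<close>

locale gevrey_heat =
  fixes a \<sigma> \<nu> :: real
  assumes a_pos: "a > 0" and sigma_gt_1: "\<sigma> > 1" and nu_pos: "\<nu> > 0"
begin

definition omega :: "real^3 \<Rightarrow> real" where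
  "omega \<xi> = exp (a * norm \<xi> powr (1 / \<sigma>))"

text \<open>Densities are \<open>ennreal\<close>-valued, so that the norm also applies to majorants
  that are infinite at some frequencies.\<close>

definition zn :: "real \<Rightarrow> (real^3 \<Rightarrow> ennreal) \<Rightarrow> ennreal" where
  "zn \<rho> f = (\<integral>\<^sup>+\<xi>. ennreal (zweight \<rho> a \<sigma> \<xi>) * f \<xi> \<partial>lborel)"

text \<open>The \<open>Z\<^sup>0\<close> norm; since \<open>0 powr 0 = 0\<close>, the weight \<open>zweight 0\<close> would vanish at the origin and fail
  to be submultiplicative there.\<close>

definition zn0 :: "(real^3 \<Rightarrow> ennreal) \<Rightarrow> ennreal" where
  "zn0 f = (\<integral>\<^sup>+\<xi>. ennreal (omega \<xi>) * f \<xi> \<partial>lborel)"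

definition conv :: "(real^3 \<Rightarrow> ennreal) \<Rightarrow> (real^3 \<Rightarrow> ennreal) \<Rightarrow> real^3 \<Rightarrow> ennreal" where
  "conv f g \<xi> = (\<integral>\<^sup>+\<eta>. f (\<xi> - \<eta>) * g \<eta> \<partial>lborel)"

text \<open>The constant \<open>12 = 3 \<cdot> 4\<close> collects crude bounds for \<open>\<xi> \<cdot> w\<close> and the Leray projection.\<close>

definition kern :: "real \<Rightarrow> real^3 \<Rightarrow> real \<Rightarrow> ennreal" where
  "kern t \<xi> s = ennreal (12 * exp (- \<nu> * (t - s) * (norm \<xi>)\<^sup>2) * norm \<xi>) * indicator {0..t} s"

text \<open>Applied to \<open>conv\<close> of two norm profiles it majorises the Duhamel term; the
  factor |\<xi>| in the kernel stands for the derivative.\<close>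

definition duh :: "(real \<Rightarrow> real^3 \<Rightarrow> ennreal) \<Rightarrow> real \<Rightarrow> real^3 \<Rightarrow> ennreal" where
  "duh h t \<xi> = (\<integral>\<^sup>+s. kern t \<xi> s * h s \<xi> \<partial>lborel)"

lemma Znorm_eq_zn: "Znorm \<rho> a \<sigma> f = zn \<rho> (\<lambda>\<xi>. ennreal (norm (f \<xi>)))"
  by (simp add: Znorm_def zn_def ennreal_mult' zweight_def)

lemma omega_nonneg [simp]: "omega \<xi> \<ge> 0"
  by (simp add: omega_def)

lemma zweight_nonneg [simp]: "zweight \<rho> a \<sigma> \<xi> \<ge> 0"
  by (simp add: zweight_def)

lemma measurable_omega [measurable]: "omega \<in> borel_measurable borel"
  unfolding omega_def[abs_def] by measurable

lemma measurable_zweight [measurable]: "zweight \<rho> a \<sigma> \<in> borel_measurable borel"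
  unfolding zweight_def[abs_def] by measurable

text \<open>Subadditivity of the power 1/\<sigma> \<le> 1 carries the triangle inequality into the
  exponent, and the exponential makes a product of the sum.\<close>

lemma omega_le_mult: "omega \<xi> \<le> omega (\<xi> - \<eta>) * omega \<eta>"
proof -
  have "norm \<xi> \<le> norm (\<xi> - \<eta>) + norm \<eta>"
    using norm_triangle_ineq[of "\<xi> - \<eta>" \<eta>] by simp
  then have "norm \<xi> powr (1 / \<sigma>) \<le> (norm (\<xi> - \<eta>) + norm \<eta>) powr (1 / \<sigma>)"
    using sigma_gt_1 by (intro powr_mono2) auto
  also have "\<dots> \<le> norm (\<xi> - \<eta>) powr (1 / \<sigma>) + norm \<eta> powr (1 / \<sigma>)"
    using sigma_gt_1 by (intro powr_add_le_add_powr) auto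
  finally have "a * norm \<xi> powr (1 / \<sigma>) \<le> a * (norm (\<xi> - \<eta>) powr (1 / \<sigma>) + norm \<eta> powr (1 / \<sigma>))"
    using a_pos by (intro mult_left_mono) auto
  then show ?thesis by (simp add: omega_def ring_distribs flip: exp_add)
qed

text \<open>The time interval varies with the argument, so its indicator is rewritten as a
  conditional on measurable inequalities.\<close>

lemma measurable_kern [measurable (raw)]:
  "(\<lambda>x. kern (t x) (f x) (s x)) \<in> borel_measurable M"
  if [measurable]: "t \<in> borel_measurable M" "f \<in> borel_measurable M" "s \<in> borel_measurable M"
proof -
  have "(\<lambda>x. kern (t x) (f x) (s x)) = (\<lambda>x. ennreal (12 * exp (- \<nu> * (t x - s x) * (norm (f x))\<^sup>2) * norm (f x))
     * (if 0 \<le> s x \<and> s x \<le> t x then 1 else 0))"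
    by (auto simp: kern_def fun_eq_iff)
  then show ?thesis by simp
qed

lemma measurable_conv [measurable (raw)]:
  assumes [measurable]: "case_prod m \<in> borel_measurable (M \<Otimes>\<^sub>M borel)"
    "case_prod n \<in> borel_measurable (M \<Otimes>\<^sub>M borel)" "f \<in> borel_measurable M"
  shows "(\<lambda>x. conv (m x) (n x) (f x)) \<in> borel_measurable M"
  unfolding conv_def by measurable

lemma measurable_duh [measurable (raw)]:
  assumes [measurable]: "case_prod h \<in> borel_measurable (borel \<Otimes>\<^sub>M borel)"
    "t \<in> borel_measurable M" "f \<in> borel_measurable M"
  shows "(\<lambda>x. duh h (t x) (f x)) \<in> borel_measurable M"
  unfolding duh_def by measurable

lemma measurable_zn [measurable (raw)]:
  assumes [measurable]: "case_prod h \<in> borel_measurable (M \<Otimes>\<^sub>M borel)"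
  shows "(\<lambda>t. zn \<rho> (h t)) \<in> borel_measurable M"
  unfolding zn_def by measurable

lemma measurable_zn0 [measurable (raw)]:
  assumes [measurable]: "case_prod h \<in> borel_measurable (M \<Otimes>\<^sub>M borel)"
  shows "(\<lambda>t. zn0 (h t)) \<in> borel_measurable M"
  unfolding zn0_def by measurable

lemma zn_mono_AE: "(AE \<xi> in lborel. f \<xi> \<le> g \<xi>) \<Longrightarrow> zn \<rho> f \<le> zn \<rho> g"
  unfolding zn_def by (intro nn_integral_mono_AE) (auto elim!: eventually_mono intro: mult_left_mono)

lemma zn0_mono_AE: "(AE \<xi> in lborel. f \<xi> \<le> g \<xi>) \<Longrightarrow> zn0 f \<le> zn0 g"
  unfolding zn0_def by (intro nn_integral_mono_AE) (auto elim!: eventually_mono intro: mult_left_mono)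

lemma zn_add:
  assumes [measurable]: "f \<in> borel_measurable borel" "g \<in> borel_measurable borel"
  shows "zn \<rho> (\<lambda>\<xi>. f \<xi> + g \<xi>) = zn \<rho> f + zn \<rho> g"
  unfolding zn_def by (simp add: distrib_left nn_integral_add)

lemma zn0_add:
  assumes [measurable]: "f \<in> borel_measurable borel" "g \<in> borel_measurable borel"
  shows "zn0 (\<lambda>\<xi>. f \<xi> + g \<xi>) = zn0 f + zn0 g"
  unfolding zn0_def by (simp add: distrib_left nn_integral_add)

text \<open>Weighted Young inequality in L^1: submultiplicativity of \<open>omega\<close>
  distributes the weight over both factors, after which Tonelli and translation invariance separate
  the integrals.\<close>

lemma zn0_conv_le:
  assumes [measurable]: "f \<in> borel_measurable borel" "g \<in> borel_measurable borel"
  shows "zn0 (conv f g) \<le> zn0 f * zn0 g"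
proof -
  let ?F = "\<lambda>x. ennreal (omega x) * f x" and ?G = "\<lambda>x. ennreal (omega x) * g x"
  have "zn0 (conv f g) = (\<integral>\<^sup>+\<xi>. \<integral>\<^sup>+\<eta>. ennreal (omega \<xi>) * (f (\<xi> - \<eta>) * g \<eta>) \<partial>lborel \<partial>lborel)"
    unfolding zn0_def conv_def by (simp add: nn_integral_cmult)
  also have "\<dots> \<le> (\<integral>\<^sup>+\<xi>. \<integral>\<^sup>+\<eta>. ?F (\<xi> - \<eta>) * ?G \<eta> \<partial>lborel \<partial>lborel)"
  proof (intro nn_integral_mono)
    fix \<xi> \<eta>
    have "ennreal (omega \<xi>) * (f (\<xi> - \<eta>) * g \<eta>) \<le> ennreal (omega (\<xi> - \<eta>) * omega \<eta>) * (f (\<xi> - \<eta>) * g \<eta>)"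
      using omega_le_mult by (intro mult_right_mono ennreal_leI) auto
    then show "ennreal (omega \<xi>) * (f (\<xi> - \<eta>) * g \<eta>) \<le> ?F (\<xi> - \<eta>) * ?G \<eta>"
      by (simp add: ennreal_mult mult_ac)
  qed
  also have "\<dots> = (\<integral>\<^sup>+\<eta>. \<integral>\<^sup>+\<xi>. ?F (\<xi> - \<eta>) * ?G \<eta> \<partial>lborel \<partial>lborel)"
    by (rule nn_integral_lborel_commute) measurable
  also have "\<dots> = (\<integral>\<^sup>+\<eta>. (\<integral>\<^sup>+\<xi>. ?F (\<xi> - \<eta>) \<partial>lborel) * ?G \<eta> \<partial>lborel)"
    by (intro nn_integral_cong nn_integral_multc) measurable
  also have "\<dots> = (\<integral>\<^sup>+\<eta>. zn0 f * ?G \<eta> \<partial>lborel)"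
    unfolding zn0_def by (subst nn_integral_lborel_minus_const[where f = ?F]) simp_all
  also have "\<dots> = zn0 f * zn0 g"
    unfolding zn0_def by (intro nn_integral_cmult) measurable
  finally show ?thesis .
qed

text \<open>The factor |\<xi>| of the kernel cancels the weight |\<xi>|^-1, and the heat factor is
  merely bounded by 1. At the origin the weight is 0.\<close>

lemma zn_minus_1_duh_le:
  assumes [measurable]: "case_prod h \<in> borel_measurable (borel \<Otimes>\<^sub>M borel)"
  shows "zn (-1) (duh h t) \<le> 12 * (\<integral>\<^sup>+s\<in>{0..t}. zn0 (h s) \<partial>lborel)"
proof -
  have "zn (-1) (duh h t) = (\<integral>\<^sup>+\<xi>. \<integral>\<^sup>+s. ennreal (zweight (-1) a \<sigma> \<xi>) * (kern t \<xi> s * h s \<xi>) \<partial>lborel \<partial>lborel)"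
    unfolding zn_def duh_def by (simp add: nn_integral_cmult)
  also have "\<dots> \<le> (\<integral>\<^sup>+\<xi>. \<integral>\<^sup>+s. 12 * (ennreal (omega \<xi>) * h s \<xi> * indicator {0..t} s) \<partial>lborel \<partial>lborel)"
  proof (intro nn_integral_mono)
    fix \<xi> s
    have "zweight (-1) a \<sigma> \<xi> * (12 * exp (- \<nu> * (t - s) * (norm \<xi>)\<^sup>2) * norm \<xi>) \<le> 12 * omega \<xi>" if "s \<le> t"
    proof (cases "\<xi> = 0")
      case False
      have "exp (- \<nu> * (t - s) * (norm \<xi>)\<^sup>2) \<le> 1"
        using that nu_pos by simp
      then show ?thesis using False
        by (simp add: zweight_def omega_def powr_minus field_simps)
    qed simp
    from ennreal_leI[OF this]
    have *: "ennreal (zweight (-1) a \<sigma> \<xi>) * ennreal (12 * exp (- \<nu> * (t - s) * (norm \<xi>)\<^sup>2) * norm \<xi>)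
         \<le> 12 * ennreal (omega \<xi>)" if "s \<le> t"
      using that by (simp add: ennreal_mult'')
    show "ennreal (zweight (-1) a \<sigma> \<xi>) * (kern t \<xi> s * h s \<xi>)
        \<le> 12 * (ennreal (omega \<xi>) * h s \<xi> * indicator {0..t} s)"
      using mult_right_mono[OF *, of "h s \<xi>"] by (auto simp: kern_def mult_ac split: split_indicator)
  qed
  also have "\<dots> = (\<integral>\<^sup>+s. \<integral>\<^sup>+\<xi>. 12 * (ennreal (omega \<xi>) * h s \<xi> * indicator {0..t} s) \<partial>lborel \<partial>lborel)"
    by (rule nn_integral_lborel_commute) measurable
  also have "\<dots> = 12 * (\<integral>\<^sup>+s\<in>{0..t}. zn0 (h s) \<partial>lborel)"
    unfolding zn0_def by (simp add: nn_integral_cmult nn_integral_multc)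
  finally show ?thesis .
qed

text \<open>Weight and kernel together give |\<xi>|^2; Tonelli brings the t integral innermost,
  where |\<xi>|^2 times the heat factor integrates to at most 1/\<nu>.\<close>

lemma nn_integral_zn_1_duh_le:
  assumes [measurable]: "case_prod h \<in> borel_measurable (borel \<Otimes>\<^sub>M borel)"
  shows "(\<integral>\<^sup>+t\<in>{0..\<tau>}. zn 1 (duh h t) \<partial>lborel) \<le> ennreal (12 / \<nu>) * (\<integral>\<^sup>+s\<in>{0..\<tau>}. zn0 (h s) \<partial>lborel)"
proof -
  let ?I = "\<lambda>t \<xi> s. ennreal (zweight 1 a \<sigma> \<xi>) * (kern t \<xi> s * h s \<xi>) * indicator {0..\<tau>} t"
  have "(\<integral>\<^sup>+t\<in>{0..\<tau>}. zn 1 (duh h t) \<partial>lborel) = (\<integral>\<^sup>+t. \<integral>\<^sup>+\<xi>. \<integral>\<^sup>+s. ?I t \<xi> s \<partial>lborel \<partial>lborel \<partial>lborel)"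
    unfolding zn_def duh_def by (simp add: nn_integral_cmult nn_integral_multc)
  also have "\<dots> = (\<integral>\<^sup>+\<xi>. \<integral>\<^sup>+t. \<integral>\<^sup>+s. ?I t \<xi> s \<partial>lborel \<partial>lborel \<partial>lborel)"
    by (rule nn_integral_lborel_commute) measurable
  also have "\<dots> = (\<integral>\<^sup>+\<xi>. \<integral>\<^sup>+s. \<integral>\<^sup>+t. ?I t \<xi> s \<partial>lborel \<partial>lborel \<partial>lborel)"
    by (intro nn_integral_cong nn_integral_lborel_commute) measurable
  also have "\<dots> \<le> (\<integral>\<^sup>+\<xi>. \<integral>\<^sup>+s. ennreal (12 / \<nu>) * (ennreal (omega \<xi>) * h s \<xi> * indicator {0..\<tau>} s) \<partial>lborel \<partial>lborel)"
  proof (intro nn_integral_mono)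
    fix \<xi> s
    let ?c = "12 * (ennreal (omega \<xi>) * h s \<xi> * indicator {0..\<tau>} s)"
    have "(\<integral>\<^sup>+t. ?I t \<xi> s \<partial>lborel)
      \<le> (\<integral>\<^sup>+t. ?c * (ennreal (exp (- \<nu> * (t - s) * (norm \<xi>)\<^sup>2) * (norm \<xi>)\<^sup>2) * indicator {s..} t) \<partial>lborel)"
    proof (rule nn_integral_mono)
      fix t
      let ?E = "exp (- \<nu> * (t - s) * (norm \<xi>)\<^sup>2)"
      have "zweight 1 a \<sigma> \<xi> * (12 * ?E * norm \<xi>) = 12 * omega \<xi> * (?E * (norm \<xi>)\<^sup>2)"
        by (simp add: zweight_def omega_def power2_eq_square)
      then have "ennreal (zweight 1 a \<sigma> \<xi>) * ennreal (12 * ?E * norm \<xi>)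
          = ennreal (12 * omega \<xi> * (?E * (norm \<xi>)\<^sup>2))"
        by (subst ennreal_mult[symmetric]) auto
      also have "\<dots> = 12 * ennreal (omega \<xi>) * ennreal (?E * (norm \<xi>)\<^sup>2)"
        by (subst ennreal_mult, simp, simp, subst ennreal_mult) auto
      finally have "ennreal (zweight 1 a \<sigma> \<xi>) * (ennreal (12 * ?E * norm \<xi>) * h s \<xi>)
          = 12 * (ennreal (omega \<xi>) * h s \<xi>) * ennreal (?E * (norm \<xi>)\<^sup>2)"
        by (subst mult.assoc[symmetric]) (simp only: mult_ac)
      then show "?I t \<xi> s \<le> ?c * (ennreal (?E * (norm \<xi>)\<^sup>2) * indicator {s..} t)"
        by (auto simp: kern_def split: split_indicator)
    qed
    also have "\<dots> = ?c * (\<integral>\<^sup>+t. ennreal (exp (- \<nu> * (t - s) * (norm \<xi>)\<^sup>2) * (norm \<xi>)\<^sup>2) * indicator {s..} t \<partial>lborel)"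
      by (rule nn_integral_cmult) measurable
    also have "\<dots> \<le> ?c * ennreal (1 / \<nu>)"
      by (intro mult_left_mono nn_integral_heat_kernel_le nu_pos) simp
    also have "ennreal (12 / \<nu>) = 12 * ennreal (1 / \<nu>)"
      using nu_pos ennreal_mult[of 12 "1 / \<nu>"] by simp
    then have "?c * ennreal (1 / \<nu>) = ennreal (12 / \<nu>) * (ennreal (omega \<xi>) * h s \<xi> * indicator {0..\<tau>} s)"
      by (simp only: mult_ac)
    finally show "(\<integral>\<^sup>+t. ?I t \<xi> s \<partial>lborel) \<le> ennreal (12 / \<nu>) * (ennreal (omega \<xi>) * h s \<xi> * indicator {0..\<tau>} s)" .
  qed
  also have "\<dots> = (\<integral>\<^sup>+s. \<integral>\<^sup>+\<xi>. ennreal (12 / \<nu>) * (ennreal (omega \<xi>) * h s \<xi> * indicator {0..\<tau>} s) \<partial>lborel \<partial>lborel)"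
    by (rule nn_integral_lborel_commute) measurable
  also have "\<dots> = ennreal (12 / \<nu>) * (\<integral>\<^sup>+s\<in>{0..\<tau>}. zn0 (h s) \<partial>lborel)"
    unfolding zn0_def by (simp add: nn_integral_cmult nn_integral_multc)
  finally show ?thesis .
qed

text \<open>Cauchy-Schwarz for |\<xi>|^(-1/2) times |\<xi>|^(1/2) with respect to the measure with
  density \<open>omega\<close> times \<open>f\<close>.\<close>

lemma zn0_power2_le:
  assumes [measurable]: "f \<in> borel_measurable borel"
  shows "(zn0 f)\<^sup>2 \<le> zn (-1) f * zn 1 f"
proof -
  define \<mu> where "\<mu> = density lborel (\<lambda>\<xi>. ennreal (omega \<xi>) * f \<xi>)"
  let ?p = "\<lambda>r \<xi>. ennreal (norm (\<xi> :: real^3) powr r)"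
  have int: "(\<integral>\<^sup>+\<xi>. g \<xi> \<partial>\<mu>) = (\<integral>\<^sup>+\<xi>. ennreal (omega \<xi>) * f \<xi> * g \<xi> \<partial>lborel)"
    if [measurable]: "g \<in> borel_measurable borel" for g
    unfolding \<mu>_def by (simp add: nn_integral_density)
  have [measurable_cong]: "sets \<mu> = sets borel" by (simp add: \<mu>_def)
  have pp: "?p r \<xi> * ?p r' \<xi> = ?p (r + r') \<xi>" for r r' \<xi>
    by (simp add: powr_add ennreal_mult)
  have "zn0 f = (\<integral>\<^sup>+\<xi>. ?p (-1/2) \<xi> * ?p (1/2) \<xi> \<partial>\<mu>)"
  proof (subst int)
    \<comment> \<open>At the origin both powers are 0 instead of having product 1, so that point is
      discarded.\<close>
    have "AE \<xi> in lborel. \<xi> \<noteq> (0 :: real^3)" by (rule AE_lborel_singleton)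
    then have "AE \<xi> in lborel. ennreal (omega \<xi>) * f \<xi> = ennreal (omega \<xi>) * f \<xi> * (?p (-1/2) \<xi> * ?p (1/2) \<xi>)"
      by eventually_elim (simp add: pp)
    then show "zn0 f = (\<integral>\<^sup>+ \<xi>. ennreal (omega \<xi>) * f \<xi> * (?p (-1/2) \<xi> * ?p (1/2) \<xi>) \<partial>lborel)"
      unfolding zn0_def by (rule nn_integral_cong_AE)
  qed measurable
  then have "(zn0 f)\<^sup>2 \<le> (\<integral>\<^sup>+\<xi>. (?p (-1/2) \<xi>)\<^sup>2 \<partial>\<mu>) * (\<integral>\<^sup>+\<xi>. (?p (1/2) \<xi>)\<^sup>2 \<partial>\<mu>)"
    by (simp only:) (rule Cauchy_Schwarz_nn_integral; measurable)
  also have "\<dots> = (\<integral>\<^sup>+\<xi>. ?p (-1) \<xi> \<partial>\<mu>) * (\<integral>\<^sup>+\<xi>. ?p 1 \<xi> \<partial>\<mu>)"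
    by (simp only: power2_eq_square pp) simp
  moreover have zn_eq: "(\<integral>\<^sup>+\<xi>. ?p r \<xi> \<partial>\<mu>) = zn r f" for r
    unfolding zn_def
    by (subst int) (simp_all add: zweight_def omega_def ennreal_mult mult_ac)
  ultimately show ?thesis by (simp only: zn_eq)
qed

lemma nn_integral_zn0_power2_le:
  fixes f :: "real \<Rightarrow> real^3 \<Rightarrow> ennreal"
  assumes [measurable]: "case_prod f \<in> borel_measurable (borel \<Otimes>\<^sub>M borel)"
    and A: "\<And>t. 0 \<le> t \<Longrightarrow> t \<le> \<tau> \<Longrightarrow> zn (-1) (f t) \<le> A"
    and B: "(\<integral>\<^sup>+t\<in>{0..\<tau>}. zn 1 (f t) \<partial>lborel) \<le> B"
  shows "(\<integral>\<^sup>+t\<in>{0..\<tau>}. (zn0 (f t))\<^sup>2 \<partial>lborel) \<le> A * B"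
proof -
  have "(\<integral>\<^sup>+t\<in>{0..\<tau>}. (zn0 (f t))\<^sup>2 \<partial>lborel) \<le> (\<integral>\<^sup>+t. A * (zn 1 (f t) * indicator {0..\<tau>} t) \<partial>lborel)"
  proof (rule nn_integral_mono)
    fix t
    have "(zn0 (f t))\<^sup>2 \<le> A * zn 1 (f t)" if "0 \<le> t" "t \<le> \<tau>"
      using zn0_power2_le[of "f t"] mult_right_mono[OF A[OF that], of "zn 1 (f t)"] by force
    then show "(zn0 (f t))\<^sup>2 * indicator {0..\<tau>} t \<le> A * (zn 1 (f t) * indicator {0..\<tau>} t)"
      by (auto split: split_indicator)
  qed
  also have "\<dots> = A * (\<integral>\<^sup>+t\<in>{0..\<tau>}. zn 1 (f t) \<partial>lborel)"
    by (rule nn_integral_cmult) measurable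
  also have "\<dots> \<le> A * B" by (intro mult_left_mono B) simp
  finally show ?thesis .
qed

text \<open>The uniform Z^-1 bound and the time-integrated Z^1 bound of the Duhamel term are
  interpolated; 144 is the product of their two factors 12.\<close>

lemma nn_integral_zn0_duh_power2_le:
  assumes [measurable]: "case_prod h \<in> borel_measurable (borel \<Otimes>\<^sub>M borel)"
  shows "(\<integral>\<^sup>+t\<in>{0..\<tau>}. (zn0 (duh h t))\<^sup>2 \<partial>lborel) \<le> ennreal (144 / \<nu>) * (\<integral>\<^sup>+s\<in>{0..\<tau>}. zn0 (h s) \<partial>lborel)\<^sup>2"
proof -
  let ?I = "\<lambda>t. \<integral>\<^sup>+s\<in>{0..t}. zn0 (h s) \<partial>lborel"
  have "(\<integral>\<^sup>+t\<in>{0..\<tau>}. (zn0 (duh h t))\<^sup>2 \<partial>lborel) \<le> (12 * ?I \<tau>) * (ennreal (12 / \<nu>) * ?I \<tau>)"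
  proof (rule nn_integral_zn0_power2_le[OF _ _ nn_integral_zn_1_duh_le])
    fix t assume "0 \<le> t" "t \<le> \<tau>"
    then have "?I t \<le> ?I \<tau>"
      by (intro nn_integral_mono) (auto split: split_indicator)
    then have "12 * ?I t \<le> 12 * ?I \<tau>" by (rule mult_left_mono) simp
    with zn_minus_1_duh_le[OF assms, of t] show "zn (-1) (duh h t) \<le> 12 * ?I \<tau>"
      by (rule order_trans)
  qed measurable
  also have "\<dots> = (12 * ennreal (12 / \<nu>)) * (?I \<tau>)\<^sup>2"
    by (simp only: power2_eq_square mult_ac)
  also have "12 * ennreal (12 / \<nu>) = ennreal (144 / \<nu>)"
    using nu_pos ennreal_mult[of 12 "12 / \<nu>"] by simp
  finally show ?thesis .
qed

end

subsection \<open>The bilinear term\<close>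

text \<open>Bilinear, without conjugation: up to the factor i this is the Fourier symbol of the
  divergence.\<close>

definition cdot :: "real^3 \<Rightarrow> complex^3 \<Rightarrow> complex" where
  "cdot \<xi> w = (\<Sum>j\<in>UNIV. complex_of_real (\<xi> $ j) * w $ j)"

text \<open>The integrand of the nonlinearity with \<open>\<eta>\<^sub>j\<close> replaced by \<open>\<xi>\<^sub>j\<close>. Unlike the original one it is
  bounded by \<open>|\<xi>|\<close>, which cancels the singular weight of \<open>Z\<^sup>-\<^sup>1\<close>, without any divergence condition.\<close>

definition bilin :: "real^3 \<Rightarrow> complex^3 \<Rightarrow> complex^3 \<Rightarrow> complex^3" where
  "bilin \<xi> x y = leray \<xi> (\<chi> k. \<i> * cdot \<xi> x * y $ k)"

lemma norm_cdot_le: "norm (cdot \<xi> w) \<le> 3 * (norm \<xi> * norm w)"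
proof -
  have "norm (cdot \<xi> w) \<le> (\<Sum>j\<in>UNIV. norm (complex_of_real (\<xi> $ j) * w $ j))"
    unfolding cdot_def by (rule norm_sum)
  also have "\<dots> \<le> of_nat (card (UNIV :: 3 set)) * (norm \<xi> * norm w)"
    by (rule sum_bounded_above)
      (auto simp: norm_mult intro!: mult_mono Finite_Cartesian_Product.norm_nth_le component_le_norm_cart)
  finally show ?thesis by simp
qed

lemma bounded_linear_cdot: "bounded_linear (cdot \<xi>)"
proof
  fix x y :: "complex^3" and r :: real
  show "cdot \<xi> (x + y) = cdot \<xi> x + cdot \<xi> y"
    by (simp add: cdot_def ring_distribs sum.distrib)
  show "cdot \<xi> (r *\<^sub>R x) = r *\<^sub>R cdot \<xi> x"
    by (simp add: cdot_def scaleR_sum_right mult_ac)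
  show "\<exists>K. \<forall>x. norm (cdot \<xi> x) \<le> norm x * K"
    using norm_cdot_le[of \<xi>] by (intro exI[of _ "3 * norm \<xi>"]) (simp add: mult_ac)
qed

lemma cdot_leray: "cdot \<xi> (leray \<xi> w) = 0"
proof (cases "\<xi> = 0")
  case True
  then show ?thesis by (simp add: cdot_def)
next
  case False
  define c where "c = cdot \<xi> w / complex_of_real ((norm \<xi>)\<^sup>2)"
  have "cdot \<xi> (leray \<xi> w) = cdot \<xi> w - c * (\<Sum>j\<in>UNIV. complex_of_real (\<xi> $ j * \<xi> $ j))"
    unfolding leray_def cdot_def[symmetric] c_def[symmetric]
    by (simp add: cdot_def algebra_simps sum_subtractf sum_distrib_left)
  also have "(\<Sum>j\<in>UNIV. complex_of_real (\<xi> $ j * \<xi> $ j)) = complex_of_real ((norm \<xi>)\<^sup>2)"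
    by (simp add: power2_norm_eq_inner inner_vec_def del: of_real_mult flip: of_real_sum)
  finally show ?thesis using False by (simp add: c_def)
qed

text \<open>4 = 1 + 3: the identity plus the removed gradient part, the latter bounded with the
  constant of \<open>norm_cdot_le\<close>.\<close>

lemma norm_leray_le: "norm (leray \<xi> w) \<le> 4 * norm w"
proof (cases "\<xi> = 0")
  case True
  \<comment> \<open>Division by zero yields zero, so at the origin the projection is the
    identity.\<close>
  then have "leray \<xi> w = w" by (simp add: leray_def vec_eq_iff)
  then show ?thesis by simp
next
  case False
  define c where "c = cdot \<xi> w / complex_of_real ((norm \<xi>)\<^sup>2)"
  define e :: "complex^3" where "e = (\<chi> k. c * complex_of_real (\<xi> $ k))"
  have "leray \<xi> w = w - e"
    by (simp add: leray_def e_def c_def cdot_def vec_eq_iff)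
  moreover have "norm e = norm c * norm \<xi>"
    by (simp add: e_def norm_vec_def norm_mult L2_set_right_distrib)
  moreover have "norm c * norm \<xi> \<le> 3 * norm w"
  proof -
    have "norm c * norm \<xi> = norm (cdot \<xi> w) / norm \<xi>"
      using False by (simp add: c_def norm_divide norm_power power2_eq_square field_simps del: of_real_power flip: of_real_mult)
    also have "\<dots> \<le> 3 * norm w"
      using norm_cdot_le[of \<xi> w] False by (simp add: field_simps)
    finally show ?thesis .
  qed
  ultimately show ?thesis using norm_triangle_ineq4[of w e] by simp
qed

lemma norm_bilin_le: "norm (bilin \<xi> x y) \<le> 12 * norm \<xi> * (norm x * norm y)"
proof -
  have "norm (\<chi> k. \<i> * cdot \<xi> x * y $ k) = norm (cdot \<xi> x) * norm y"
    by (simp add: norm_vec_def norm_mult L2_set_right_distrib)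
  also have "\<dots> \<le> 3 * (norm \<xi> * norm x) * norm y"
    by (intro mult_right_mono norm_cdot_le) simp
  finally show ?thesis
    using norm_leray_le[of \<xi> "\<chi> k. \<i> * cdot \<xi> x * y $ k"] unfolding bilin_def by simp
qed

lemma leray_add: "leray \<xi> (x + y) = leray \<xi> x + leray \<xi> y"
  by (simp add: leray_def vec_eq_iff ring_distribs sum.distrib add_divide_distrib)

lemma bilin_diff: "bilin \<xi> x y - bilin \<xi> x' y' = bilin \<xi> (x - x') y + bilin \<xi> x' (y - y')"
proof -
  have "cdot \<xi> (x - x') = cdot \<xi> x - cdot \<xi> x'"
    by (rule bounded_linear.linear[OF bounded_linear_cdot, THEN linear_diff])
  then have "cdot \<xi> x = cdot \<xi> (x - x') + cdot \<xi> x'" by simp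
  then have "(\<chi> k. \<i> * cdot \<xi> x * y $ k) = (\<chi> k. \<i> * cdot \<xi> (x - x') * y $ k) + ((\<chi> k. \<i> * cdot \<xi> x' * (y - y') $ k)
      + (\<chi> k. \<i> * cdot \<xi> x' * y' $ k))"
    by (simp only: vec_eq_iff vec_lambda_beta vector_add_component vector_minus_component) (simp add: algebra_simps)
  then show ?thesis unfolding bilin_def by (simp add: leray_add)
qed

lemma leray_nonlin_integrand:
  assumes "cdot (\<xi> - \<eta>) (w (\<xi> - \<eta>)) = 0"
  shows "leray \<xi> (nonlin_integrand w \<xi> \<eta>) = bilin \<xi> (w (\<xi> - \<eta>)) (w \<eta>)"
proof -
  have "cdot \<xi> (w (\<xi> - \<eta>)) = cdot \<eta> (w (\<xi> - \<eta>))"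
    using assms by (simp add: cdot_def algebra_simps sum_subtractf)
  then show ?thesis
    unfolding bilin_def nonlin_integrand_def
    by (simp add: cdot_def sum_distrib_left sum_distrib_right mult_ac)
qed

lemma measurable_cdot [measurable (raw)]:
  assumes [measurable]: "f \<in> borel_measurable M" "x \<in> borel_measurable M"
  shows "(\<lambda>z. cdot (f z) (x z)) \<in> borel_measurable M"
  unfolding cdot_def by measurable

lemma measurable_leray [measurable (raw)]:
  assumes [measurable]: "f \<in> borel_measurable M" "x \<in> borel_measurable M"
  shows "(\<lambda>z. leray (f z) (x z)) \<in> borel_measurable M"
  by (rule borel_measurable_complex_vec) (simp add: leray_def del: of_real_power)

lemma measurable_bilin [measurable (raw)]:
  assumes [measurable]: "f \<in> borel_measurable M" "x \<in> borel_measurable M" "y \<in> borel_measurable M"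
  shows "(\<lambda>z. bilin (f z) (x z) (y z)) \<in> borel_measurable M"
proof -
  have [measurable]: "(\<lambda>z. \<chi> k. \<i> * cdot (f z) (x z) * y z $ k) \<in> borel_measurable M"
    by (rule borel_measurable_complex_vec) simp
  show ?thesis unfolding bilin_def by measurable
qed

lemma measurable_nonlin_integrand [measurable (raw)]:
  assumes [measurable]: "case_prod w \<in> borel_measurable (borel \<Otimes>\<^sub>M borel)"
    "t \<in> borel_measurable M" "f \<in> borel_measurable M" "g \<in> borel_measurable M"
  shows "(\<lambda>z. nonlin_integrand (w (t z)) (f z) (g z)) \<in> borel_measurable M"
  by (rule borel_measurable_complex_vec) (simp add: nonlin_integrand_def)

text \<open>Dominated convergence: the indicators of the strips converge off the slice at time t,
  which is a null set.\<close>

lemma continuous_on_integral_strip: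
  fixes J :: "real \<times> 'b::euclidean_space \<Rightarrow> 'c::{banach, second_countable_topology}"
  assumes J: "set_integrable lborel ({0..T} \<times> UNIV) J"
  shows "continuous_on {0..T} (\<lambda>t. LINT p : {0..t} \<times> UNIV | lborel. J p)"
proof (rule continuous_on_sequentiallyI)
  fix x t assume x: "\<forall>n. x n \<in> {0..T}" "t \<in> {0..T}" "x \<longlonglongrightarrow> t"
  let ?J = "\<lambda>p. indicat_real ({0..T} \<times> UNIV) p *\<^sub>R J p"
  let ?S = "\<lambda>t p. indicat_real ({0..t} \<times> UNIV) p *\<^sub>R ?J p"
  have int: "integrable lborel ?J" using J by (simp add: set_integrable_def)
  then have meas: "?J \<in> borel_measurable borel" by (simp add: borel_measurable_integrable flip: measurable_lborel2)
  have "{0..t} \<times> (UNIV :: 'b set) \<in> sets borel" for t :: real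
    by (simp add: borel_closed closed_Times)
  then have meas': "?S t \<in> borel_measurable borel" for t
    by (intro borel_measurable_scaleR[OF borel_measurable_indicator meas])
  have eq: "(LINT p : {0..t} \<times> UNIV | lborel. J p) = (\<integral>p. ?S t p \<partial>lborel)" if "t \<in> {0..T}" for t
    unfolding set_lebesgue_integral_def using that
    by (intro Bochner_Integration.integral_cong) (auto simp: indicator_def)
  have "(\<lambda>n. \<integral>p. ?S (x n) p \<partial>lborel) \<longlonglongrightarrow> (\<integral>p. ?S t p \<partial>lborel)"
  proof (rule integral_dominated_convergence)
    show "integrable lborel (\<lambda>p. norm (?J p))" using int by (rule integrable_norm)
    have "AE p in (lborel :: (real \<times> 'b) measure). fst p \<noteq> t"
    proof (rule AE_lborel_pairI)
      show "AE x in lborel. AE y in (lborel :: 'b measure). fst (x, y) \<noteq> t"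
        using AE_lborel_singleton[of t] by eventually_elim simp
    qed simp
    then show "AE p in lborel. (\<lambda>n. ?S (x n) p) \<longlonglongrightarrow> ?S t p"
    proof eventually_elim
      case (elim p)
      have "\<forall>\<^sub>F n in sequentially. (fst p \<le> x n) = (fst p \<le> t)"
      proof (cases "fst p < t")
        case True
        from order_tendstoD(1)[OF x(3) this] show ?thesis
          by eventually_elim (use True in auto)
      next
        case False
        with elim have "t < fst p" by auto
        from order_tendstoD(2)[OF x(3) this] show ?thesis
          by eventually_elim (use \<open>t < fst p\<close> in auto)
      qed
      then have "\<forall>\<^sub>F n in sequentially. ?S (x n) p = ?S t p"
        by eventually_elim (auto simp: indicator_def mem_Times_iff)
      then show ?case by (rule tendsto_eventually)
    qed
    show "AE p in lborel. norm (?S (x n) p) \<le> norm (?J p)" for n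
      by (auto simp: indicator_def)
  qed (use meas' in \<open>auto simp only: measurable_lborel2\<close>)
  then show "(\<lambda>n. LINT p : {0..x n} \<times> UNIV | lborel. J p) \<longlonglongrightarrow> (LINT p : {0..t} \<times> UNIV | lborel. J p)"
    using x by (simp only: eq)
qed

section \<open>Scalar majorants of the Duhamel integrals\<close>

context gevrey_heat
begin

abbreviation nrm :: "(real \<Rightarrow> real^3 \<Rightarrow> complex^3) \<Rightarrow> real \<Rightarrow> real^3 \<Rightarrow> ennreal" where
  "nrm v \<equiv> \<lambda>s \<eta>. ennreal (norm (v s \<eta>))"

text \<open>The indicator of the strip is built in, so integrals run over the whole space and
  equalities almost everywhere transfer directly.\<close>

definition integrand :: "(real \<Rightarrow> real^3 \<Rightarrow> complex^3) \<Rightarrow> real \<Rightarrow> real^3 \<Rightarrow> real \<times> (real^3) \<Rightarrow> complex^3" where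
  "integrand v t \<xi> p = indicat_real ({0..t} \<times> UNIV) p *\<^sub>R
     ((exp (- \<nu> * (t - fst p) * (norm \<xi>)\<^sup>2) / (2 * pi) ^ 3)
       *\<^sub>R bilin \<xi> (v (fst p) (\<xi> - snd p)) (v (fst p) (snd p)))"

lemma indicator_strip: "indicat_real ({0..t} \<times> UNIV) p = indicat_real {0..t} (fst p)"
  by (auto simp: indicator_def mem_Times_iff)

lemma measurable_indicator_Icc [measurable (raw)]:
  fixes t s :: "'a \<Rightarrow> real"
  assumes [measurable]: "t \<in> borel_measurable M" "s \<in> borel_measurable M"
  shows "(\<lambda>x. indicat_real {0..t x} (s x)) \<in> borel_measurable M"
proof -
  have "(\<lambda>x. indicat_real {0..t x} (s x)) = (\<lambda>x. if 0 \<le> s x \<and> s x \<le> t x then 1 else 0)"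
    by (auto simp: fun_eq_iff indicator_def)
  then show ?thesis by simp
qed

lemma measurable_integrand [measurable (raw)]:
  assumes [measurable]: "case_prod v \<in> borel_measurable (borel \<Otimes>\<^sub>M borel)"
    "t \<in> borel_measurable M" "f \<in> borel_measurable M" "p \<in> measurable M (borel \<Otimes>\<^sub>M borel)"
  shows "(\<lambda>x. integrand v (t x) (f x) (p x)) \<in> borel_measurable M"
  unfolding integrand_def indicator_strip by measurable

lemma measurable_integrand_lborel:
  assumes [measurable]: "case_prod v \<in> borel_measurable (borel \<Otimes>\<^sub>M borel)"
  shows "integrand v t \<xi> \<in> borel_measurable lborel"
proof -
  have "(\<lambda>p. integrand v t \<xi> p) \<in> borel_measurable (borel \<Otimes>\<^sub>M borel)" by measurable
  then show ?thesis by (simp add: borel_prod)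
qed

lemma norm_integrand_le:
  "ennreal (norm (integrand v t \<xi> p)) \<le> kern t \<xi> (fst p) * (nrm v (fst p) (\<xi> - snd p) * nrm v (fst p) (snd p))"
  "ennreal (norm (integrand v t \<xi> p - integrand w t \<xi> p)) \<le> kern t \<xi> (fst p) *
     (nrm (\<lambda>s \<eta>. v s \<eta> - w s \<eta>) (fst p) (\<xi> - snd p) * nrm v (fst p) (snd p)
      + nrm w (fst p) (\<xi> - snd p) * nrm (\<lambda>s \<eta>. v s \<eta> - w s \<eta>) (fst p) (snd p))"
proof -
  let ?E = "exp (- \<nu> * (t - fst p) * (norm \<xi>)\<^sup>2)"
  \<comment> \<open>The Fourier normalisation (2 pi)^-3 is at most 1 and is dropped from the
    majorant.\<close>
  have E: "?E / (2 * pi) ^ 3 \<le> ?E"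
  proof -
    have "1 \<le> (2 * pi) ^ 3" using pi_gt3 by (intro one_le_power) simp
    then show ?thesis by (simp add: divide_le_eq)
  qed
  \<comment> \<open>Serves both estimates: z is either one value of \<open>bilin\<close> or the sum
    of two.\<close>
  have gen: "ennreal (norm (indicat_real ({0..t} \<times> UNIV) p *\<^sub>R ((?E / (2 * pi) ^ 3) *\<^sub>R z)))
     \<le> kern t \<xi> (fst p) * c" if z: "norm z \<le> 12 * norm \<xi> * r" and r: "r \<ge> 0" "ennreal r = c" for z r c
  proof -
    have "norm ((?E / (2 * pi) ^ 3) *\<^sub>R z) = (?E / (2 * pi) ^ 3) * norm z" by simp
    also have "\<dots> \<le> ?E * (12 * norm \<xi> * r)" using E z by (intro mult_mono) auto
    also have "\<dots> = 12 * ?E * norm \<xi> * r" by simp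
    finally have "ennreal (norm ((?E / (2 * pi) ^ 3) *\<^sub>R z)) \<le> ennreal (12 * ?E * norm \<xi>) * c"
      unfolding r(2)[symmetric] using r(1) by (subst ennreal_mult[symmetric]) (auto intro: ennreal_leI)
    then show ?thesis
      by (cases "fst p \<in> {0..t}") (simp_all only: kern_def indicator_strip indicator_simps, simp_all)
  qed
  show "ennreal (norm (integrand v t \<xi> p)) \<le> kern t \<xi> (fst p) * (nrm v (fst p) (\<xi> - snd p) * nrm v (fst p) (snd p))"
    unfolding integrand_def by (rule gen[OF norm_bilin_le]) (auto simp: ennreal_mult)
  have eq: "integrand v t \<xi> p - integrand w t \<xi> p = indicat_real ({0..t} \<times> UNIV) p *\<^sub>R ((?E / (2 * pi) ^ 3) *\<^sub>R
     (bilin \<xi> (v (fst p) (\<xi> - snd p) - w (fst p) (\<xi> - snd p)) (v (fst p) (snd p))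
     + bilin \<xi> (w (fst p) (\<xi> - snd p)) (v (fst p) (snd p) - w (fst p) (snd p))))"
    unfolding integrand_def bilin_diff[symmetric] by (simp add: algebra_simps)
  show "ennreal (norm (integrand v t \<xi> p - integrand w t \<xi> p)) \<le> kern t \<xi> (fst p) *
     (nrm (\<lambda>s \<eta>. v s \<eta> - w s \<eta>) (fst p) (\<xi> - snd p) * nrm v (fst p) (snd p)
      + nrm w (fst p) (\<xi> - snd p) * nrm (\<lambda>s \<eta>. v s \<eta> - w s \<eta>) (fst p) (snd p))"
    unfolding eq
  proof (rule gen)
    let ?d1 = "v (fst p) (\<xi> - snd p) - w (fst p) (\<xi> - snd p)" and ?d2 = "v (fst p) (snd p) - w (fst p) (snd p)"
    show "norm (bilin \<xi> ?d1 (v (fst p) (snd p)) + bilin \<xi> (w (fst p) (\<xi> - snd p)) ?d2) \<le>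
      12 * norm \<xi> * (norm ?d1 * norm (v (fst p) (snd p)) + norm (w (fst p) (\<xi> - snd p)) * norm ?d2)"
      unfolding distrib_left[of "12 * norm \<xi>"] by (intro norm_triangle_mono norm_bilin_le)
  qed (auto simp: ennreal_mult)
qed

lemma duh_conv_eq:
  assumes [measurable]: "case_prod m \<in> borel_measurable (borel \<Otimes>\<^sub>M borel)"
    "case_prod n \<in> borel_measurable (borel \<Otimes>\<^sub>M borel)"
  shows "duh (\<lambda>s. conv (m s) (n s)) t \<xi> = (\<integral>\<^sup>+p. kern t \<xi> (fst p) * (m (fst p) (\<xi> - snd p) * n (fst p) (snd p)) \<partial>lborel)"
proof -
  have "duh (\<lambda>s. conv (m s) (n s)) t \<xi> = (\<integral>\<^sup>+s. \<integral>\<^sup>+\<eta>. kern t \<xi> s * (m s (\<xi> - \<eta>) * n s \<eta>) \<partial>lborel \<partial>lborel)"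
    unfolding duh_def conv_def by (simp add: nn_integral_cmult)
  also have "\<dots> = (\<integral>\<^sup>+p. kern t \<xi> (fst p) * (m (fst p) (\<xi> - snd p) * n (fst p) (snd p)) \<partial>lborel)"
    by (rule nn_integral_lborel_pair[symmetric]) measurable
  finally show ?thesis .
qed

lemma integrable_integrand:
  assumes [measurable]: "case_prod v \<in> borel_measurable (borel \<Otimes>\<^sub>M borel)"
    "case_prod m \<in> borel_measurable (borel \<Otimes>\<^sub>M borel)"
    and le: "\<And>s \<eta>. nrm v s \<eta> \<le> m s \<eta>"
    and fin: "duh (\<lambda>s. conv (m s) (m s)) t \<xi> < \<infinity>"
  shows "integrable lborel (integrand v t \<xi>)"
proof (rule integrableI_bounded)
  show "integrand v t \<xi> \<in> borel_measurable lborel"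
    by (rule measurable_integrand_lborel) fact
  have "(\<integral>\<^sup>+p. ennreal (norm (integrand v t \<xi> p)) \<partial>lborel) \<le> duh (\<lambda>s. conv (m s) (m s)) t \<xi>"
    unfolding duh_conv_eq[OF assms(2,2)]
    by (intro nn_integral_mono order_trans[OF norm_integrand_le(1)] mult_mono le) auto
  then show "(\<integral>\<^sup>+p. ennreal (norm (integrand v t \<xi> p)) \<partial>lborel) < \<infinity>"
    using fin by (rule order.strict_trans1)
qed

lemma norm_integral_integrand_diff_le:
  assumes [measurable]: "case_prod v \<in> borel_measurable (borel \<Otimes>\<^sub>M borel)"
    "case_prod w \<in> borel_measurable (borel \<Otimes>\<^sub>M borel)"
    and int: "integrable lborel (integrand v t \<xi>)" "integrable lborel (integrand w t \<xi>)"
  shows "ennreal (norm ((\<integral>p. integrand v t \<xi> p \<partial>lborel) - (\<integral>p. integrand w t \<xi> p \<partial>lborel)))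
    \<le> (\<integral>\<^sup>+p. ennreal (norm (integrand v t \<xi> p - integrand w t \<xi> p)) \<partial>lborel)"
  unfolding Bochner_Integration.integral_diff[OF int, symmetric]
  by (intro integral_norm_bound_ennreal Bochner_Integration.integrable_diff int)

text \<open>Induction step of the comparison between vector and scalar iteration. The difference of
  the quadratic terms splits into one part with v - w in the first slot and one with it in the
  second, mirroring n n - m m = (n - m) n + m (n - m) for the majorants. If the right-hand side is
  infinite there is nothing to prove; otherwise it makes both Bochner integrals converge.\<close>

lemma integral_integrand_diff_majorant:
  assumes [measurable]: "case_prod v \<in> borel_measurable (borel \<Otimes>\<^sub>M borel)"
    "case_prod w \<in> borel_measurable (borel \<Otimes>\<^sub>M borel)"
    "case_prod m \<in> borel_measurable (borel \<Otimes>\<^sub>M borel)"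
    "case_prod n \<in> borel_measurable (borel \<Otimes>\<^sub>M borel)"
    and v: "\<And>s \<eta>. nrm v s \<eta> \<le> n s \<eta>" and w: "\<And>s \<eta>. nrm w s \<eta> \<le> m s \<eta>"
    and d: "\<And>s \<eta>. ennreal (norm (v s \<eta> - w s \<eta>)) + m s \<eta> \<le> n s \<eta>"
  shows "ennreal (norm ((\<integral>p. integrand v t \<xi> p \<partial>lborel) - (\<integral>p. integrand w t \<xi> p \<partial>lborel)))
     + duh (\<lambda>s. conv (m s) (m s)) t \<xi> \<le> duh (\<lambda>s. conv (n s) (n s)) t \<xi>"
proof (cases "duh (\<lambda>s. conv (n s) (n s)) t \<xi> < \<infinity>")
  case False
  then show ?thesis by (simp add: less_top[symmetric])
next
  case True
  have mn: "m s \<eta> \<le> n s \<eta>" for s \<eta>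
    using d[of s \<eta>] by (meson add_increasing order_refl order_trans zero_le)
  have iv: "integrable lborel (integrand v t \<xi>)"
    by (rule integrable_integrand[OF _ _ v True]) measurable
  have iw: "integrable lborel (integrand w t \<xi>)"
    by (rule integrable_integrand[OF _ _ order_trans[OF w mn] True]) measurable
  let ?D = "\<lambda>p. ennreal (norm (integrand v t \<xi> p - integrand w t \<xi> p))"
  let ?k = "\<lambda>m p. kern t \<xi> (fst p) * (m (fst p) (\<xi> - snd p) * m (fst p) (snd p))"
  have "?k m \<in> borel_measurable (borel \<Otimes>\<^sub>M borel)" by measurable
  then have mk: "?k m \<in> borel_measurable borel" by (simp add: borel_prod)
  have "?D \<in> borel_measurable (borel \<Otimes>\<^sub>M borel)" by measurable
  then have mD: "?D \<in> borel_measurable borel" by (simp add: borel_prod)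
  have "ennreal (norm ((\<integral>p. integrand v t \<xi> p \<partial>lborel) - (\<integral>p. integrand w t \<xi> p \<partial>lborel)))
     + duh (\<lambda>s. conv (m s) (m s)) t \<xi> \<le> (\<integral>\<^sup>+p. ?D p \<partial>lborel) + (\<integral>\<^sup>+p. ?k m p \<partial>lborel)"
    unfolding duh_conv_eq[OF assms(3,3)]
    by (intro add_mono norm_integral_integrand_diff_le iv iw order_refl) measurable
  also have "\<dots> = (\<integral>\<^sup>+p. ?D p + ?k m p \<partial>lborel)"
    by (rule nn_integral_add[symmetric]) (simp_all only: measurable_lborel2 mD mk)
  also have "\<dots> \<le> (\<integral>\<^sup>+p. ?k n p \<partial>lborel)"
  proof (rule nn_integral_mono)
    fix p :: "real \<times> (real^3)"
    define s x y where "s = fst p" and "x = \<xi> - snd p" and "y = snd p"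
    let ?d = "\<lambda>\<eta>. ennreal (norm (v s \<eta> - w s \<eta>))"
    have "(?d x * nrm v s y + nrm w s x * ?d y) + m s x * m s y \<le> (?d x * n s y + m s x * ?d y) + m s x * m s y"
      by (intro add_mono mult_mono v w order_refl) auto
    also have "\<dots> = ?d x * n s y + m s x * (?d y + m s y)"
      by (simp add: distrib_left add.assoc)
    also have "\<dots> \<le> ?d x * n s y + m s x * n s y"
      by (intro add_mono mult_mono d order_refl) auto
    also have "\<dots> = (?d x + m s x) * n s y" by (simp add: distrib_right)
    also have "\<dots> \<le> n s x * n s y" by (intro mult_right_mono d) simp
    finally have "kern t \<xi> s * ((?d x * nrm v s y + nrm w s x * ?d y) + m s x * m s y) \<le> kern t \<xi> s * (n s x * n s y)"
      by (rule mult_left_mono) simp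
    then show "?D p + ?k m p \<le> ?k n p"
      using norm_integrand_le(2)[of v t \<xi> p w] unfolding s_def x_def y_def distrib_left
      by (meson add_right_mono order_trans)
  qed
  also have "\<dots> = duh (\<lambda>s. conv (n s) (n s)) t \<xi>"
    by (rule duh_conv_eq[OF assms(4,4), symmetric])
  finally show ?thesis .
qed

end

lemma tendsto_bilin:
  assumes x: "X \<longlonglongrightarrow> x" and y: "Y \<longlonglongrightarrow> y"
  shows "(\<lambda>n. bilin \<xi> (X n) (Y n)) \<longlonglongrightarrow> bilin \<xi> x y"
proof (rule Lim_transform2)
  show "(\<lambda>n. bilin \<xi> x y) \<longlonglongrightarrow> bilin \<xi> x y" by simp
  have "(\<lambda>n. bilin \<xi> (X n) (Y n) - bilin \<xi> x y) \<longlonglongrightarrow> 0"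
  proof (rule Lim_null_comparison)
    show "\<forall>\<^sub>F n in sequentially. norm (bilin \<xi> (X n) (Y n) - bilin \<xi> x y)
        \<le> 12 * norm \<xi> * (norm (X n - x) * norm (Y n)) + 12 * norm \<xi> * (norm x * norm (Y n - y))"
      unfolding bilin_diff by (intro always_eventually allI norm_triangle_mono norm_bilin_le)
    have "(\<lambda>n. 12 * norm \<xi> * (norm (X n - x) * norm (Y n)) + 12 * norm \<xi> * (norm x * norm (Y n - y)))
       \<longlonglongrightarrow> 12 * norm \<xi> * (norm (x - x) * norm y) + 12 * norm \<xi> * (norm x * norm (y - y))"
      by (intro tendsto_intros x y)
    then show "(\<lambda>n. 12 * norm \<xi> * (norm (X n - x) * norm (Y n)) + 12 * norm \<xi> * (norm x * norm (Y n - y))) \<longlonglongrightarrow> 0"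
      by simp
  qed
  then show "(\<lambda>n. bilin \<xi> x y - bilin \<xi> (X n) (Y n)) \<longlonglongrightarrow> 0"
    using tendsto_minus[of "\<lambda>n. bilin \<xi> (X n) (Y n) - bilin \<xi> x y" 0 sequentially] by simp
qed

lemma bilin_zero [simp]: "bilin \<xi> 0 y = 0"
  using norm_bilin_le[of \<xi> 0 y] by simp

lemma ennreal_norm_le_diff_add: "ennreal (norm x) \<le> ennreal (norm (x - y)) + ennreal (norm y)"
  using ennreal_leI[OF norm_triangle_sub[of x y]] by (simp add: add.commute)

lemma power2_add_le_ennreal: "(x + y)\<^sup>2 \<le> 2 * x\<^sup>2 + 2 * y\<^sup>2" for x y :: ennreal
proof -
  have "(x + y)\<^sup>2 = x\<^sup>2 + y\<^sup>2 + 2 * x * y"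
    by (simp add: power2_sum)
  also have "\<dots> \<le> x\<^sup>2 + y\<^sup>2 + (x\<^sup>2 + y\<^sup>2)"
    by (intro add_left_mono sum_of_squares_ge_ennreal)
  also have "\<dots> = 2 * x\<^sup>2 + 2 * y\<^sup>2"
    unfolding mult_2 by (simp add: ac_simps)
  finally show ?thesis .
qed

text \<open>The square is a double supremum, which monotonicity reduces to the diagonal via max i
  j.\<close>

lemma power2_SUP_ennreal:
  fixes f :: "nat \<Rightarrow> ennreal"
  assumes "incseq f"
  shows "(SUP n. f n)\<^sup>2 = (SUP n. (f n)\<^sup>2)"
proof (rule antisym)
  have "(SUP n. f n) * (SUP n. f n) \<le> (SUP n. (f n)\<^sup>2)"
    unfolding SUP_mult_left_ennreal SUP_mult_right_ennreal
  proof (intro SUP_least)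
    fix i j
    have "f i * f j \<le> (f (max i j))\<^sup>2"
      unfolding power2_eq_square using assms by (intro mult_mono) (auto simp: incseq_def)
    also have "\<dots> \<le> (SUP n. (f n)\<^sup>2)" by (rule SUP_upper) simp
    finally show "f i * f j \<le> (SUP n. (f n)\<^sup>2)" .
  qed
  then show "(SUP n. f n)\<^sup>2 \<le> (SUP n. (f n)\<^sup>2)" by (simp add: power2_eq_square)
  show "(SUP n. (f n)\<^sup>2) \<le> (SUP n. f n)\<^sup>2"
    by (intro SUP_least power_mono SUP_upper) auto
qed

section \<open>Finiteness of the Duhamel majorant at almost every frequency\<close>

context gevrey_heat
begin

lemma duh_mono: "(\<And>s. h s \<xi> \<le> h' s \<xi>) \<Longrightarrow> duh h t \<xi> \<le> duh h' t \<xi>"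
  unfolding duh_def by (intro nn_integral_mono mult_left_mono) auto

lemma conv_mono: "(\<And>\<eta>. f \<eta> \<le> f' \<eta>) \<Longrightarrow> (\<And>\<eta>. g \<eta> \<le> g' \<eta>) \<Longrightarrow> conv f g \<xi> \<le> conv f' g' \<xi>"
  unfolding conv_def by (intro nn_integral_mono mult_mono) auto

text \<open>The squared L^2 Z^0 norm on {0..T}, the quantity in which the iteration closes.\<close>

definition qn :: "real \<Rightarrow> (real \<Rightarrow> real^3 \<Rightarrow> ennreal) \<Rightarrow> ennreal" where
  "qn T m = (\<integral>\<^sup>+t\<in>{0..T}. (zn0 (m t))\<^sup>2 \<partial>lborel)"

text \<open>What remains of the Duhamel majorant when the heat factor and the power of |\<xi>| are
  stripped. It does not depend on t, so its finiteness at \<xi> settles all times up to T and yields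
  a single null set of frequencies.\<close>

definition sconv :: "real \<Rightarrow> (real \<Rightarrow> real^3 \<Rightarrow> ennreal) \<Rightarrow> real^3 \<Rightarrow> ennreal" where
  "sconv T m \<xi> = (\<integral>\<^sup>+s\<in>{0..T}. conv (m s) (m s) \<xi> \<partial>lborel)"

lemma measurable_sconv [measurable (raw)]:
  assumes [measurable]: "case_prod m \<in> borel_measurable (borel \<Otimes>\<^sub>M borel)" "f \<in> borel_measurable M"
  shows "(\<lambda>x. sconv T m (f x)) \<in> borel_measurable M"
  unfolding sconv_def by measurable

lemma nn_integral_zn0_conv_le_qn:
  assumes [measurable]: "case_prod m \<in> borel_measurable (borel \<Otimes>\<^sub>M borel)"
  shows "(\<integral>\<^sup>+s\<in>{0..T}. zn0 (conv (m s) (m s)) \<partial>lborel) \<le> qn T m"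
  unfolding qn_def power2_eq_square
  by (intro nn_integral_mono mult_right_mono zn0_conv_le) simp_all

lemma zn0_sconv_le:
  assumes [measurable]: "case_prod m \<in> borel_measurable (borel \<Otimes>\<^sub>M borel)"
  shows "zn0 (sconv T m) \<le> qn T m"
proof -
  have "zn0 (sconv T m) = (\<integral>\<^sup>+\<xi>. \<integral>\<^sup>+s. ennreal (omega \<xi>) * conv (m s) (m s) \<xi> * indicator {0..T} s \<partial>lborel \<partial>lborel)"
    unfolding zn0_def sconv_def by (simp add: nn_integral_cmult mult.assoc)
  also have "\<dots> = (\<integral>\<^sup>+s. \<integral>\<^sup>+\<xi>. ennreal (omega \<xi>) * conv (m s) (m s) \<xi> * indicator {0..T} s \<partial>lborel \<partial>lborel)"
    by (rule nn_integral_lborel_commute) measurable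
  also have "\<dots> = (\<integral>\<^sup>+s\<in>{0..T}. zn0 (conv (m s) (m s)) \<partial>lborel)"
    unfolding zn0_def by (simp add: nn_integral_multc)
  also have "\<dots> \<le> qn T m" by (rule nn_integral_zn0_conv_le_qn) fact
  finally show ?thesis .
qed

lemma AE_sconv_finite:
  assumes [measurable]: "case_prod m \<in> borel_measurable (borel \<Otimes>\<^sub>M borel)" and "qn T m < \<infinity>"
  shows "AE \<xi> in lborel. sconv T m \<xi> < \<infinity>"
proof -
  have "zn0 (sconv T m) < \<infinity>"
    using zn0_sconv_le[OF assms(1)] assms(2) by (rule order.strict_trans1)
  then have "AE \<xi> in lborel. ennreal (omega \<xi>) * sconv T m \<xi> \<noteq> \<infinity>"
    unfolding zn0_def by (intro nn_integral_PInf_AE) auto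
  then show ?thesis
  proof eventually_elim
    case (elim \<xi>)
    have "omega \<xi> > 0" by (simp add: omega_def)
    then show ?case using elim by (auto simp: ennreal_mult_eq_top_iff less_top)
  qed
qed

lemma duh_le_sconv:
  assumes "t \<le> T" and [measurable]: "case_prod m \<in> borel_measurable (borel \<Otimes>\<^sub>M borel)"
  shows "duh (\<lambda>s. conv (m s) (m s)) t \<xi> \<le> ennreal (12 * norm \<xi>) * sconv T m \<xi>"
proof -
  have "duh (\<lambda>s. conv (m s) (m s)) t \<xi> \<le> (\<integral>\<^sup>+s. ennreal (12 * norm \<xi>) * (conv (m s) (m s) \<xi> * indicator {0..T} s) \<partial>lborel)"
    unfolding duh_def
  proof (rule nn_integral_mono)
    fix s
    have "12 * exp (- \<nu> * (t - s) * (norm \<xi>)\<^sup>2) * norm \<xi> \<le> 12 * 1 * norm \<xi>" if "s \<le> t"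
      using that nu_pos by (intro mult_mono) auto
    then have "kern t \<xi> s \<le> ennreal (12 * norm \<xi>) * indicator {0..T} s"
      using \<open>t \<le> T\<close> by (auto simp: kern_def indicator_def intro!: ennreal_leI)
    from mult_right_mono[OF this, of "conv (m s) (m s) \<xi>"]
    show "kern t \<xi> s * conv (m s) (m s) \<xi> \<le> ennreal (12 * norm \<xi>) * (conv (m s) (m s) \<xi> * indicator {0..T} s)"
      by (simp add: mult_ac)
  qed
  also have "\<dots> = ennreal (12 * norm \<xi>) * sconv T m \<xi>"
    unfolding sconv_def by (rule nn_integral_cmult) measurable
  finally show ?thesis .
qed

lemma duh_finite_if_sconv_finite:
  assumes "sconv T m \<xi> < \<infinity>" "t \<le> T" and "case_prod m \<in> borel_measurable (borel \<Otimes>\<^sub>M borel)"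
  shows "duh (\<lambda>s. conv (m s) (m s)) t \<xi> < \<infinity>"
  using duh_le_sconv[OF assms(2,3), of \<xi>] assms(1)
  by (auto simp: ennreal_mult_less_top intro: order.strict_trans1)

text \<open>Supplies the time-independent dominating function for continuity in Z^-1: the factor
  |\<xi>| cancels the singular weight and leaves \<open>zn0\<close> of \<open>sconv\<close>.\<close>

lemma zn_minus_1_sconv_finite:
  assumes [measurable]: "case_prod m \<in> borel_measurable (borel \<Otimes>\<^sub>M borel)" and "qn T m < \<infinity>"
  shows "zn (-1) (\<lambda>\<xi>. ennreal (12 * norm \<xi>) * sconv T m \<xi>) < \<infinity>"
proof -
  have "zn (-1) (\<lambda>\<xi>. ennreal (12 * norm \<xi>) * sconv T m \<xi>) \<le> (\<integral>\<^sup>+\<xi>. 12 * (ennreal (omega \<xi>) * sconv T m \<xi>) \<partial>lborel)"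
    unfolding zn_def
  proof (rule nn_integral_mono)
    fix \<xi>
    have "zweight (-1) a \<sigma> \<xi> * (12 * norm \<xi>) \<le> 12 * omega \<xi>"
      by (cases "\<xi> = 0") (simp_all add: zweight_def omega_def powr_minus)
    from ennreal_leI[OF this]
    have "ennreal (zweight (-1) a \<sigma> \<xi>) * ennreal (12 * norm \<xi>) \<le> 12 * ennreal (omega \<xi>)"
      by (simp add: ennreal_mult'')
    from mult_right_mono[OF this, of "sconv T m \<xi>"]
    show "ennreal (zweight (-1) a \<sigma> \<xi>) * (ennreal (12 * norm \<xi>) * sconv T m \<xi>)
        \<le> 12 * (ennreal (omega \<xi>) * sconv T m \<xi>)"
      by (simp add: mult.assoc)
  qed
  also have "\<dots> = 12 * zn0 (sconv T m)"
    unfolding zn0_def by (rule nn_integral_cmult) measurable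
  also have "\<dots> < \<infinity>"
    using order.strict_trans1[OF zn0_sconv_le[OF assms(1)] assms(2)] by (simp add: ennreal_mult_less_top)
  finally show ?thesis .
qed

end

subsection \<open>Picard iteration and its majorant\<close>

locale ns_data = gevrey_heat +
  fixes u0 :: "real^3 \<Rightarrow> complex^3"
  assumes u0_measurable [measurable]: "u0 \<in> borel_measurable borel"
    and u0_finite: "zn (-1) (\<lambda>\<xi>. ennreal (norm (u0 \<xi>))) < \<infinity>"
    and u0_div_free: "AE \<xi> in lborel. cdot \<xi> (u0 \<xi>) = 0"
begin

definition heat_flow :: "real \<Rightarrow> real^3 \<Rightarrow> complex^3" where
  "heat_flow t \<xi> = exp (- \<nu> * t * (norm \<xi>)\<^sup>2) *\<^sub>R u0 \<xi>"

definition picard_map :: "(real \<Rightarrow> real^3 \<Rightarrow> complex^3) \<Rightarrow> real \<Rightarrow> real^3 \<Rightarrow> complex^3" where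
  "picard_map v t \<xi> = heat_flow t \<xi> - (\<integral>p. integrand v t \<xi> p \<partial>lborel)"

text \<open>One null set of frequencies serves all times, \<open>v\<close> is jointly Borel, and
  \<open>bilin\<close> replaces the nonlinearity. Finiteness of \<open>qn\<close> stands in for the
  norm conditions of a mild solution, which are recovered from the equation.\<close>

definition fixpoint :: "real \<Rightarrow> (real \<Rightarrow> real^3 \<Rightarrow> complex^3) \<Rightarrow> bool" where
  "fixpoint T v \<longleftrightarrow> case_prod v \<in> borel_measurable (borel \<Otimes>\<^sub>M borel) \<and> qn T (nrm v) < \<infinity> \<and>
     (AE \<xi> in lborel. \<forall>t\<in>{0..T}. integrable lborel (integrand v t \<xi>) \<and> v t \<xi> = picard_map v t \<xi>)"

lemma measurable_heat_flow [measurable (raw)]: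
  assumes [measurable]: "t \<in> borel_measurable M" "f \<in> borel_measurable M"
  shows "(\<lambda>x. heat_flow (t x) (f x)) \<in> borel_measurable M"
  unfolding heat_flow_def by measurable

lemma measurable_picard_map [measurable]:
  assumes [measurable]: "case_prod v \<in> borel_measurable (borel \<Otimes>\<^sub>M borel)"
  shows "case_prod (picard_map v) \<in> borel_measurable (borel \<Otimes>\<^sub>M borel)"
proof -
  let ?f = "\<lambda>(x :: real \<times> (real^3)) p. integrand v (fst x) (snd x) p"
  have sets: "sets ((borel \<Otimes>\<^sub>M borel) \<Otimes>\<^sub>M lborel) = sets ((borel \<Otimes>\<^sub>M borel) \<Otimes>\<^sub>M (borel \<Otimes>\<^sub>M borel)
      :: ((real \<times> (real^3)) \<times> (real \<times> (real^3))) measure)"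
    by (rule sets_pair_measure_cong) (simp_all only: sets_lborel borel_prod)
  have "case_prod ?f \<in> borel_measurable ((borel \<Otimes>\<^sub>M borel) \<Otimes>\<^sub>M (borel \<Otimes>\<^sub>M borel))" by measurable
  then have "case_prod ?f \<in> borel_measurable ((borel \<Otimes>\<^sub>M borel) \<Otimes>\<^sub>M lborel)"
    by (subst measurable_cong_sets[OF sets refl])
  from lborel.borel_measurable_lebesgue_integral[OF this]
  have [measurable]: "(\<lambda>x. \<integral>p. integrand v (fst x) (snd x) p \<partial>lborel) \<in> borel_measurable (borel \<Otimes>\<^sub>M borel)" .
  show ?thesis unfolding picard_map_def case_prod_beta' by measurable
qed

lemma nrm_heat_flow_le: "t \<ge> 0 \<Longrightarrow> nrm heat_flow t \<xi> \<le> ennreal (norm (u0 \<xi>))"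
  using nu_pos by (auto simp: heat_flow_def intro!: ennreal_leI mult_left_le_one_le)

text \<open>The weight of Z^1 is |\<xi>|^2 times that of Z^-1, and this extra factor is the one that
  the heat kernel absorbs when integrated in time.\<close>

lemma nn_integral_zn_1_heat_flow_le:
  "(\<integral>\<^sup>+t\<in>{0..\<tau>}. zn 1 (nrm heat_flow t) \<partial>lborel) \<le> ennreal (1 / \<nu>) * zn (-1) (\<lambda>\<xi>. ennreal (norm (u0 \<xi>)))"
proof -
  let ?I = "\<lambda>t \<xi>. ennreal (zweight 1 a \<sigma> \<xi>) * nrm heat_flow t \<xi> * indicator {0..\<tau>} t"
  let ?c = "\<lambda>\<xi>. ennreal (zweight (-1) a \<sigma> \<xi>) * ennreal (norm (u0 \<xi>))"
  have "(\<integral>\<^sup>+t\<in>{0..\<tau>}. zn 1 (nrm heat_flow t) \<partial>lborel) = (\<integral>\<^sup>+t. \<integral>\<^sup>+\<xi>. ?I t \<xi> \<partial>lborel \<partial>lborel)"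
    unfolding zn_def by (simp add: nn_integral_multc)
  also have "\<dots> = (\<integral>\<^sup>+\<xi>. \<integral>\<^sup>+t. ?I t \<xi> \<partial>lborel \<partial>lborel)"
    by (rule nn_integral_lborel_commute) measurable
  also have "\<dots> \<le> (\<integral>\<^sup>+\<xi>. ?c \<xi> * ennreal (1 / \<nu>) \<partial>lborel)"
  proof (rule nn_integral_mono)
    fix \<xi>
    have "(\<integral>\<^sup>+t. ?I t \<xi> \<partial>lborel)
      \<le> (\<integral>\<^sup>+t. ?c \<xi> * (ennreal (exp (- \<nu> * (t - 0) * (norm \<xi>)\<^sup>2) * (norm \<xi>)\<^sup>2) * indicator {0..} t) \<partial>lborel)"
    proof (rule nn_integral_mono)
      fix t
      have "zweight 1 a \<sigma> \<xi> * norm (heat_flow t \<xi>)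
         = zweight (-1) a \<sigma> \<xi> * norm (u0 \<xi>) * (exp (- \<nu> * (t - 0) * (norm \<xi>)\<^sup>2) * (norm \<xi>)\<^sup>2)"
        by (cases "\<xi> = 0") (simp_all add: zweight_def heat_flow_def powr_minus power2_eq_square field_simps)
      then have "ennreal (zweight 1 a \<sigma> \<xi>) * nrm heat_flow t \<xi>
         = ?c \<xi> * ennreal (exp (- \<nu> * (t - 0) * (norm \<xi>)\<^sup>2) * (norm \<xi>)\<^sup>2)"
        by (simp only: ennreal_mult[symmetric] zweight_nonneg norm_ge_zero mult_nonneg_nonneg exp_ge_zero zero_le_power2)
      then show "?I t \<xi> \<le> ?c \<xi> * (ennreal (exp (- \<nu> * (t - 0) * (norm \<xi>)\<^sup>2) * (norm \<xi>)\<^sup>2) * indicator {0..} t)"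
        by (auto split: split_indicator)
    qed
    also have "\<dots> = ?c \<xi> * (\<integral>\<^sup>+t. ennreal (exp (- \<nu> * (t - 0) * (norm \<xi>)\<^sup>2) * (norm \<xi>)\<^sup>2) * indicator {0..} t \<partial>lborel)"
      by (rule nn_integral_cmult) measurable
    also have "\<dots> \<le> ?c \<xi> * ennreal (1 / \<nu>)"
      by (intro mult_left_mono nn_integral_heat_kernel_le nu_pos) simp
    finally show "(\<integral>\<^sup>+t. ?I t \<xi> \<partial>lborel) \<le> ?c \<xi> * ennreal (1 / \<nu>)" .
  qed
  also have "\<dots> = ennreal (1 / \<nu>) * zn (-1) (\<lambda>\<xi>. ennreal (norm (u0 \<xi>)))"
    unfolding zn_def by (subst nn_integral_multc) (simp_all only: mult.commute, simp_all)
  finally show ?thesis .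
qed

text \<open>Interpolation makes the integral over {0..1} finite, and absolute continuity makes it
  small on a short initial interval; the length 1 is arbitrary.\<close>

lemma qn_heat_flow_small:
  assumes "\<epsilon> > 0"
  shows "\<exists>T>0. qn T (nrm heat_flow) \<le> ennreal \<epsilon>"
proof -
  let ?U = "zn (-1) (\<lambda>\<xi>. ennreal (norm (u0 \<xi>)))"
  have "(\<integral>\<^sup>+t\<in>{0..1}. (zn0 (nrm heat_flow t))\<^sup>2 \<partial>lborel) \<le> ?U * (ennreal (1 / \<nu>) * ?U)"
  proof (rule nn_integral_zn0_power2_le[OF _ _ nn_integral_zn_1_heat_flow_le])
    show "case_prod (nrm heat_flow) \<in> borel_measurable (borel \<Otimes>\<^sub>M borel)" by measurable
    show "zn (-1) (nrm heat_flow t) \<le> ?U" if "0 \<le> t" "t \<le> 1" for t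
      using nrm_heat_flow_le[OF that(1)] by (intro zn_mono_AE) simp
  qed
  also have "\<dots> < \<infinity>" using u0_finite by (simp add: ennreal_mult_less_top)
  finally have fin: "(\<integral>\<^sup>+t\<in>{0..1}. (zn0 (nrm heat_flow t))\<^sup>2 \<partial>lborel) < \<infinity>" .
  have "(\<lambda>t. (zn0 (nrm heat_flow t))\<^sup>2) \<in> borel_measurable borel" by measurable
  from nn_integral_small_on_short_intervals[OF this fin assms] obtain \<delta> where "\<delta> > 0"
    and "\<And>x y. 0 \<le> x \<Longrightarrow> x \<le> y \<Longrightarrow> y \<le> 1 \<Longrightarrow> y - x \<le> \<delta>
       \<Longrightarrow> (\<integral>\<^sup>+t\<in>{x..y}. (zn0 (nrm heat_flow t))\<^sup>2 \<partial>lborel) < ennreal \<epsilon>"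
    by auto
  then have "(\<integral>\<^sup>+t\<in>{0..min 1 \<delta>}. (zn0 (nrm heat_flow t))\<^sup>2 \<partial>lborel) < ennreal \<epsilon>" by simp
  then show ?thesis using \<open>\<delta> > 0\<close> unfolding qn_def
    by (intro exI[of _ "min 1 \<delta>"]) (auto intro: less_imp_le)
qed

section \<open>The two iterations and their limits\<close>

primrec picard :: "nat \<Rightarrow> real \<Rightarrow> real^3 \<Rightarrow> complex^3" where
  "picard 0 = (\<lambda>_ _. 0)"
| "picard (Suc n) = picard_map (picard n)"

text \<open>Fields are replaced by norms and the minus sign of the Duhamel term by a plus, so that
  all contributions are nonnegative and the sequence increases. It starts at 0 together with
  \<open>picard\<close>.\<close>

primrec scalar_picard :: "nat \<Rightarrow> real \<Rightarrow> real^3 \<Rightarrow> ennreal" where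
  "scalar_picard 0 = (\<lambda>_ _. 0)"
| "scalar_picard (Suc n) = (\<lambda>t \<xi>. nrm heat_flow t \<xi> + duh (\<lambda>s. conv (scalar_picard n s) (scalar_picard n s)) t \<xi>)"

definition majorant :: "real \<Rightarrow> real^3 \<Rightarrow> ennreal" where
  "majorant t \<xi> = (SUP n. scalar_picard n t \<xi>)"

text \<open>Where the iterates diverge, \<open>lim\<close> is an unspecified value; there
  \<open>majorant\<close> is infinite, so bounds by it still hold.\<close>

definition sol :: "real \<Rightarrow> real^3 \<Rightarrow> complex^3" where
  "sol t \<xi> = lim (\<lambda>n. picard n t \<xi>)"

lemma measurable_picard [measurable]: "case_prod (picard n) \<in> borel_measurable (borel \<Otimes>\<^sub>M borel)"
  by (induction n) simp_all

lemma measurable_scalar_picard [measurable]: "case_prod (scalar_picard n) \<in> borel_measurable (borel \<Otimes>\<^sub>M borel)"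
proof (induction n)
  case (Suc n)
  note [measurable] = Suc
  show ?case unfolding scalar_picard.simps by measurable
qed simp

lemma measurable_majorant [measurable]: "case_prod majorant \<in> borel_measurable (borel \<Otimes>\<^sub>M borel)"
  unfolding majorant_def[abs_def] case_prod_beta' by measurable

lemma measurable_sol [measurable]: "case_prod sol \<in> borel_measurable (borel \<Otimes>\<^sub>M borel)"
  unfolding sol_def[abs_def] case_prod_beta' by measurable

text \<open>Holds at every point, also where the Bochner integrals diverge: there the right-hand side is
  infinite. The summand \<open>scalar_picard n\<close> on the left replaces a subtraction in \<open>ennreal\<close>.\<close>

lemma picard_scalar_picard_step:
  "ennreal (norm (picard (Suc n) t \<xi> - picard n t \<xi>)) + scalar_picard n t \<xi> \<le> scalar_picard (Suc n) t \<xi> \<and> nrm (picard n) t \<xi> \<le> scalar_picard n t \<xi>"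
proof (induction n arbitrary: t \<xi>)
  case 0
  have "integrand (\<lambda>_ _. 0) t \<xi> p = 0" for p by (simp add: integrand_def)
  then show ?case by (simp add: picard_map_def)
next
  case (Suc n)
  have bound: "nrm (picard (Suc n)) s \<eta> \<le> scalar_picard (Suc n) s \<eta>" for s \<eta>
  proof -
    have "nrm (picard (Suc n)) s \<eta> \<le> ennreal (norm (picard (Suc n) s \<eta> - picard n s \<eta>)) + nrm (picard n) s \<eta>"
      by (rule ennreal_norm_le_diff_add)
    also have "\<dots> \<le> ennreal (norm (picard (Suc n) s \<eta> - picard n s \<eta>)) + scalar_picard n s \<eta>"
      using Suc by (intro add_left_mono) blast
    also have "\<dots> \<le> scalar_picard (Suc n) s \<eta>" using Suc by blast
    finally show ?thesis .
  qed
  have "ennreal (norm (picard (Suc (Suc n)) t \<xi> - picard (Suc n) t \<xi>))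
      = ennreal (norm ((\<integral>p. integrand (picard (Suc n)) t \<xi> p \<partial>lborel) - (\<integral>p. integrand (picard n) t \<xi> p \<partial>lborel)))"
    unfolding picard.simps(2)[of "Suc n"] by (subst picard.simps(2)[of n]) (simp add: picard_map_def norm_minus_commute)
  then have "ennreal (norm (picard (Suc (Suc n)) t \<xi> - picard (Suc n) t \<xi>)) + scalar_picard (Suc n) t \<xi>
      = nrm heat_flow t \<xi> + (ennreal (norm ((\<integral>p. integrand (picard (Suc n)) t \<xi> p \<partial>lborel) - (\<integral>p. integrand (picard n) t \<xi> p \<partial>lborel)))
        + duh (\<lambda>s. conv (scalar_picard n s) (scalar_picard n s)) t \<xi>)"
    by (simp only: scalar_picard.simps(2)) (simp only: ac_simps)
  also have "\<dots> \<le> nrm heat_flow t \<xi> + duh (\<lambda>s. conv (scalar_picard (Suc n) s) (scalar_picard (Suc n) s)) t \<xi>"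
    by (intro add_left_mono integral_integrand_diff_majorant[OF measurable_picard measurable_picard measurable_scalar_picard measurable_scalar_picard])
      (use Suc bound in blast)+
  finally show ?case using bound unfolding scalar_picard.simps(2)[of "Suc n"] by blast
qed

lemma incseq_scalar_picard: "incseq (\<lambda>n. scalar_picard n t \<xi>)"
proof (rule incseq_SucI)
  fix n
  have "scalar_picard n t \<xi> \<le> ennreal (norm (picard (Suc n) t \<xi> - picard n t \<xi>)) + scalar_picard n t \<xi>" by (simp add: add_increasing)
  then show "scalar_picard n t \<xi> \<le> scalar_picard (Suc n) t \<xi>" using picard_scalar_picard_step order_trans by blast
qed

lemma scalar_picard_le_majorant: "scalar_picard n t \<xi> \<le> majorant t \<xi>"
  unfolding majorant_def by (rule SUP_upper) simp

lemma nrm_picard_le_majorant: "nrm (picard n) t \<xi> \<le> majorant t \<xi>"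
  using picard_scalar_picard_step[of n t \<xi>] scalar_picard_le_majorant[of n t \<xi>] by (blast intro: order_trans)

lemma picard_tendsto_sol:
  assumes "majorant t \<xi> < \<infinity>"
  shows "(\<lambda>n. picard n t \<xi>) \<longlonglongrightarrow> sol t \<xi>"
proof -
  have "convergent (\<lambda>n. picard n t \<xi>)"
    using picard_scalar_picard_step assms unfolding majorant_def
    by (intro convergent_if_dominated_by_ennreal_seq[where m = "\<lambda>n. scalar_picard n t \<xi>"]) blast+
  then show ?thesis unfolding sol_def by (simp add: convergent_LIMSEQ_iff)
qed

lemma nrm_sol_le: "nrm sol t \<xi> \<le> majorant t \<xi>"
proof (cases "majorant t \<xi> < \<infinity>")
  case True
  have "(\<lambda>n. nrm (picard n) t \<xi>) \<longlonglongrightarrow> nrm sol t \<xi>"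
    by (intro tendsto_ennrealI tendsto_norm picard_tendsto_sol True)
  then show ?thesis by (rule LIMSEQ_le_const2) (use nrm_picard_le_majorant in blast)
next
  case False
  then show ?thesis by (simp add: less_top[symmetric])
qed

text \<open>Each iterate is 0 or the scalar map applied to an earlier iterate, which lies below the
  supremum, and the map is monotone. This transfers finiteness from the Duhamel term to
  \<open>majorant\<close> itself.\<close>

lemma majorant_le: "majorant t \<xi> \<le> nrm heat_flow t \<xi> + duh (\<lambda>s. conv (majorant s) (majorant s)) t \<xi>"
  unfolding majorant_def[of t]
proof (rule SUP_least)
  fix n
  show "scalar_picard n t \<xi> \<le> nrm heat_flow t \<xi> + duh (\<lambda>s. conv (majorant s) (majorant s)) t \<xi>"
    by (cases n) (auto intro!: add_left_mono duh_mono conv_mono scalar_picard_le_majorant)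
qed

text \<open>With K = 144/\<nu> and q the value for the heat flow, one iteration takes a bound x to 2
  q + 2 K x^2. The bound 1/(4 K) = \<nu>/576 is preserved if q \<le> 1/(16 K) = \<nu>/2304, both
  summands then being at most 1/(8 K).\<close>

lemma qn_scalar_picard_le:
  assumes heat_flow: "qn T (nrm heat_flow) \<le> ennreal (\<nu> / 2304)"
  shows "qn T (scalar_picard n) \<le> ennreal (\<nu> / 576)"
proof (induction n)
  case 0
  show ?case by (simp add: qn_def zn0_def)
next
  case (Suc n)
  let ?h = "\<lambda>s. conv (scalar_picard n s) (scalar_picard n s)"
  have "qn T (scalar_picard (Suc n)) \<le> (\<integral>\<^sup>+t. 2 * ((zn0 (nrm heat_flow t))\<^sup>2 * indicator {0..T} t) + 2 * ((zn0 (duh ?h t))\<^sup>2 * indicator {0..T} t) \<partial>lborel)"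
    unfolding qn_def
  proof (rule nn_integral_mono)
    fix t
    have "zn0 (scalar_picard (Suc n) t) = zn0 (nrm heat_flow t) + zn0 (duh ?h t)"
      unfolding scalar_picard.simps by (rule zn0_add) measurable
    then show "(zn0 (scalar_picard (Suc n) t))\<^sup>2 * indicator {0..T} t
       \<le> 2 * ((zn0 (nrm heat_flow t))\<^sup>2 * indicator {0..T} t) + 2 * ((zn0 (duh ?h t))\<^sup>2 * indicator {0..T} t)"
      using power2_add_le_ennreal by (auto split: split_indicator)
  qed
  also have "\<dots> = 2 * qn T (nrm heat_flow) + 2 * (\<integral>\<^sup>+t\<in>{0..T}. (zn0 (duh ?h t))\<^sup>2 \<partial>lborel)"
    unfolding qn_def by (simp add: nn_integral_add nn_integral_cmult)
  also have "\<dots> \<le> 2 * ennreal (\<nu> / 2304) + 2 * (ennreal (144 / \<nu>) * (ennreal (\<nu> / 576))\<^sup>2)"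
  proof (intro add_mono mult_left_mono heat_flow)
    have "(\<integral>\<^sup>+t\<in>{0..T}. (zn0 (duh ?h t))\<^sup>2 \<partial>lborel) \<le> ennreal (144 / \<nu>) * (\<integral>\<^sup>+s\<in>{0..T}. zn0 (?h s) \<partial>lborel)\<^sup>2"
      by (rule nn_integral_zn0_duh_power2_le) measurable
    also have "\<dots> \<le> ennreal (144 / \<nu>) * (ennreal (\<nu> / 576))\<^sup>2"
      by (intro mult_left_mono power_mono order_trans[OF nn_integral_zn0_conv_le_qn Suc]) simp_all
    finally show "(\<integral>\<^sup>+t\<in>{0..T}. (zn0 (duh ?h t))\<^sup>2 \<partial>lborel) \<le> ennreal (144 / \<nu>) * (ennreal (\<nu> / 576))\<^sup>2" .
  qed simp_all
  also have "\<dots> = ennreal (2 * (\<nu> / 2304) + 2 * (144 / \<nu> * (\<nu> / 576)\<^sup>2))"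
  proof -
    have e: "2 * ennreal x = ennreal (2 * x)" if "x \<ge> 0" for x
      using that by (simp add: ennreal_mult)
    have "2 * (ennreal (144 / \<nu>) * (ennreal (\<nu> / 576))\<^sup>2) = ennreal (2 * (144 / \<nu> * (\<nu> / 576)\<^sup>2))"
      using nu_pos by (subst ennreal_power, simp, subst ennreal_mult[symmetric], simp, simp, intro e) simp
    moreover have "2 * ennreal (\<nu> / 2304) = ennreal (2 * (\<nu> / 2304))"
      using nu_pos by (intro e) simp
    ultimately show ?thesis
      using nu_pos by (simp only:) (rule ennreal_plus[symmetric]; simp)
  qed
  also have "2 * (\<nu> / 2304) + 2 * (144 / \<nu> * (\<nu> / 576)\<^sup>2) = \<nu> / 576"
    using nu_pos by (simp add: field_simps power2_eq_square)
  finally show ?case .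
qed

text \<open>Monotone convergence, first in frequency and then in time, passes the uniform bound on
  the iterates to their supremum.\<close>

lemma qn_majorant_finite:
  assumes "qn T (nrm heat_flow) \<le> ennreal (\<nu> / 2304)"
  shows "qn T majorant < \<infinity>"
proof -
  have z: "zn0 (majorant t) = (SUP n. zn0 (scalar_picard n t))" for t
    unfolding zn0_def majorant_def SUP_mult_left_ennreal
    using incseq_scalar_picard by (intro nn_integral_monotone_convergence_SUP)
      (auto simp: incseq_def le_fun_def intro!: mult_left_mono)
  have inc: "incseq (\<lambda>n. zn0 (scalar_picard n t))" for t
    by (intro incseq_SucI zn0_mono_AE AE_I2 incseq_SucD[OF incseq_scalar_picard])
  have "qn T majorant = (\<integral>\<^sup>+t. (SUP n. (zn0 (scalar_picard n t))\<^sup>2 * indicator {0..T} t) \<partial>lborel)"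
    unfolding qn_def z power2_SUP_ennreal[OF inc] SUP_mult_right_ennreal ..
  also have "\<dots> = (SUP n. qn T (scalar_picard n))"
    unfolding qn_def
    using inc by (intro nn_integral_monotone_convergence_SUP)
      (auto simp: incseq_def le_fun_def intro!: mult_right_mono power_mono)
  also have "\<dots> \<le> ennreal (\<nu> / 576)" by (intro SUP_least qn_scalar_picard_le assms)
  finally show ?thesis using le_less_trans ennreal_less_top by (metis infinity_ennreal_def)
qed

text \<open>Dominated convergence with the kernel built from \<open>majorant\<close>, whose integral
  is the \<open>duh\<close> term assumed finite.\<close>

lemma integral_integrand_picard_tendsto:
  assumes ae: "AE \<eta> in lborel. \<forall>s\<in>{0..T}. majorant s \<eta> < \<infinity>"
    and fin: "duh (\<lambda>s. conv (majorant s) (majorant s)) t \<xi> < \<infinity>" and "t \<le> T"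
  shows "(\<lambda>n. \<integral>p. integrand (picard n) t \<xi> p \<partial>lborel) \<longlonglongrightarrow> (\<integral>p. integrand sol t \<xi> p \<partial>lborel)"
proof -
  define k where "k p = kern t \<xi> (fst p) * (majorant (fst p) (\<xi> - snd p) * majorant (fst p) (snd p))" for p
  have "k \<in> borel_measurable (borel \<Otimes>\<^sub>M borel)" unfolding k_def by measurable
  then have k_meas: "k \<in> borel_measurable borel" by (simp add: borel_prod)
  have k_int: "(\<integral>\<^sup>+p. k p \<partial>lborel) < \<infinity>"
    using fin unfolding k_def duh_conv_eq[OF measurable_majorant measurable_majorant] .
  show ?thesis
  proof (rule integral_dominated_convergence)
    show "integrable lborel (\<lambda>p. enn2real (k p))"
    proof (rule integrableI_nonneg)
      have "(\<integral>\<^sup>+p. ennreal (enn2real (k p)) \<partial>lborel) \<le> (\<integral>\<^sup>+p. k p \<partial>lborel)"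
        by (intro nn_integral_mono) (simp add: ennreal_enn2real_if)
      then show "(\<integral>\<^sup>+p. ennreal (enn2real (k p)) \<partial>lborel) < \<infinity>"
        using k_int by (rule order.strict_trans1)
    qed (use k_meas in auto)
    have "AE p in lborel. k p \<noteq> \<infinity>"
      using k_int k_meas by (intro nn_integral_PInf_AE) auto
    then show "AE p in lborel. norm (integrand (picard n) t \<xi> p) \<le> enn2real (k p)" for n
    proof eventually_elim
      case (elim p)
      have "ennreal (norm (integrand (picard n) t \<xi> p)) \<le> kern t \<xi> (fst p) * (nrm (picard n) (fst p) (\<xi> - snd p) * nrm (picard n) (fst p) (snd p))"
        by (rule norm_integrand_le)
      also have "\<dots> \<le> k p"
        unfolding k_def by (intro mult_left_mono mult_mono nrm_picard_le_majorant) simp_all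
      finally have "ennreal (norm (integrand (picard n) t \<xi> p)) \<le> ennreal (enn2real (k p))"
        using elim by (simp add: ennreal_enn2real_if)
      then show ?case by (subst (asm) ennreal_le_iff) simp_all
    qed
    \<comment> \<open>The integrand at (s, \<eta>) uses the iterates at \<eta> and at \<xi> -
      \<eta>, so the reflected null set is discarded as well.\<close>
    have "AE \<eta> in lborel. (\<forall>s\<in>{0..T}. majorant s \<eta> < \<infinity>) \<and> (\<forall>s\<in>{0..T}. majorant s (\<xi> - \<eta>) < \<infinity>)"
      using ae AE_lborel_diff[OF ae, of \<xi>] by eventually_elim simp
    from AE_lborel_snd[OF this, where 'a = real]
    show "AE p in lborel. (\<lambda>n. integrand (picard n) t \<xi> p) \<longlonglongrightarrow> integrand sol t \<xi> p"
    proof eventually_elim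
      case (elim p)
      show ?case
      proof (cases "fst p \<in> {0..t}")
        case True
        then have "fst p \<in> {0..T}" using \<open>t \<le> T\<close> by auto
        then have "majorant (fst p) (\<xi> - snd p) < \<infinity>" "majorant (fst p) (snd p) < \<infinity>"
          using elim by blast+
        then show ?thesis unfolding integrand_def
          by (intro tendsto_scaleR tendsto_const tendsto_bilin picard_tendsto_sol)
      next
        case False
        then show ?thesis by (simp add: integrand_def indicator_strip)
      qed
    qed
  qed (intro measurable_integrand_lborel measurable_picard measurable_sol)+
qed

lemma fixpoint_exists: "\<exists>T>0. \<exists>v. fixpoint T v"
proof -
  from qn_heat_flow_small[of "\<nu> / 2304"] nu_pos
  obtain T where T: "T > 0" "qn T (nrm heat_flow) \<le> ennreal (\<nu> / 2304)" by auto
  have qM: "qn T majorant < \<infinity>" by (rule qn_majorant_finite[OF T(2)])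
  have zn0_sol: "zn0 (nrm sol t) \<le> zn0 (majorant t)" for t
    by (intro zn0_mono_AE AE_I2 nrm_sol_le)
  have "qn T (nrm sol) \<le> qn T majorant"
    unfolding qn_def by (intro nn_integral_mono mult_right_mono power_mono zn0_sol) simp_all
  then have q: "qn T (nrm sol) < \<infinity>" using qM by (rule order.strict_trans1)
  have fin: "AE \<xi> in lborel. sconv T majorant \<xi> < \<infinity>"
    by (rule AE_sconv_finite[OF measurable_majorant qM])
  \<comment> \<open>Finiteness of the time-integrated convolution at \<xi> bounds the majorant there
    for all t \<le> T, so the exceptional set of frequencies is independent of t.\<close>
  have Mfin: "majorant t \<xi> < \<infinity>" if "sconv T majorant \<xi> < \<infinity>" "t \<le> T" for t \<xi>
    using duh_finite_if_sconv_finite[OF that measurable_majorant] majorant_le[of t \<xi>]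
    by (auto intro: order.strict_trans1)
  have aeM: "AE \<eta> in lborel. \<forall>s\<in>{0..T}. majorant s \<eta> < \<infinity>"
    using fin by eventually_elim (use Mfin in auto)
  have "AE \<xi> in lborel. \<forall>t\<in>{0..T}. integrable lborel (integrand sol t \<xi>) \<and> sol t \<xi> = picard_map sol t \<xi>"
    using fin
  proof (eventually_elim, intro ballI conjI)
    fix \<xi> t assume *: "sconv T majorant \<xi> < \<infinity>" "t \<in> {0..T}"
    then have d: "duh (\<lambda>s. conv (majorant s) (majorant s)) t \<xi> < \<infinity>"
      by (intro duh_finite_if_sconv_finite measurable_majorant) auto
    then show "integrable lborel (integrand sol t \<xi>)"
      by (rule integrable_integrand[OF measurable_sol measurable_majorant nrm_sol_le])
    have "(\<lambda>n. picard_map (picard n) t \<xi>) \<longlonglongrightarrow> picard_map sol t \<xi>"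
      unfolding picard_map_def using *(2)
      by (intro tendsto_diff tendsto_const integral_integrand_picard_tendsto[OF aeM d]) auto
    \<comment> \<open>The same sequence is the Picard iteration shifted by one, so uniqueness of
      limits gives the equation.\<close>
    moreover have "(\<lambda>n. picard_map (picard n) t \<xi>) \<longlonglongrightarrow> sol t \<xi>"
      using LIMSEQ_Suc[OF picard_tendsto_sol[OF Mfin[OF *(1)]]] *(2) by simp
    ultimately show "sol t \<xi> = picard_map sol t \<xi>" by (rule LIMSEQ_unique[symmetric])
  qed
  then have "fixpoint T sol" unfolding fixpoint_def using q measurable_sol by blast
  then show ?thesis using T(1) by blast
qed

end

subsection \<open>Mild solutions as fixed points\<close>

text \<open>The semigroup law factors out the dependence on t: what remains is the integrand of the
  final time T, cut off to a growing strip.\<close>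

lemma duhamel_factor:
  fixes N :: "real \<times> 'b::euclidean_space \<Rightarrow> 'c::{banach, second_countable_topology}"
  assumes "t \<le> T"
  shows "indicat_real ({0..t} \<times> UNIV) p *\<^sub>R ((exp (- \<nu> * (t - fst p) * r) / c) *\<^sub>R N p)
     = exp (\<nu> * (T - t) * r) *\<^sub>R (indicat_real ({0..t} \<times> UNIV) p *\<^sub>R
         (indicat_real ({0..T} \<times> UNIV) p *\<^sub>R ((exp (- \<nu> * (T - fst p) * r) / c) *\<^sub>R N p)))"
proof -
  have "exp (- \<nu> * (t - fst p) * r) = exp (\<nu> * (T - t) * r) * exp (- \<nu> * (T - fst p) * r)"
    by (simp add: algebra_simps flip: exp_add)
  then show ?thesis using assms by (auto simp: indicator_def)
qed

text \<open>By this factorisation, integrability at the final time controls all earlier times, and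
  continuity reduces to a continuous scalar factor times the integral of a fixed function over a
  growing strip.\<close>

lemma
  fixes N :: "real \<times> 'b::euclidean_space \<Rightarrow> 'c::{banach, second_countable_topology}"
  assumes int: "set_integrable lborel ({0..T} \<times> UNIV) (\<lambda>p. (exp (- \<nu> * (T - fst p) * r) / c) *\<^sub>R N p)"
  shows set_integrable_duhamel: "t \<le> T \<Longrightarrow>
      set_integrable lborel ({0..t} \<times> UNIV) (\<lambda>p. (exp (- \<nu> * (t - fst p) * r) / c) *\<^sub>R N p)" (is "_ \<Longrightarrow> ?int t")
    and continuous_on_duhamel: "continuous_on {0..T}
      (\<lambda>t. LINT p : {0..t} \<times> UNIV | lborel. (exp (- \<nu> * (t - fst p) * r) / c) *\<^sub>R N p)"
proof -
  let ?J = "\<lambda>t p. (exp (- \<nu> * (t - fst p) * r) / c) *\<^sub>R N p"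
  have sub: "set_integrable lborel ({0..t} \<times> UNIV) (?J T)" if "t \<le> T" for t
    using int by (rule set_integrable_subset) (use that in \<open>auto simp: borel_closed closed_Times\<close>)
  have fac: "indicat_real ({0..t} \<times> UNIV) p *\<^sub>R ?J t p
     = exp (\<nu> * (T - t) * r) *\<^sub>R (indicat_real ({0..t} \<times> UNIV) p *\<^sub>R ?J T p)" if "t \<le> T" for t p
    unfolding duhamel_factor[OF that] using that by (auto simp: indicator_def)
  show "?int t" if "t \<le> T"
    unfolding set_integrable_def fac[OF that]
    using sub[OF that] unfolding set_integrable_def by (intro integrable_scaleR_right) auto
  have "continuous_on {0..T} (\<lambda>t. exp (\<nu> * (T - t) * r) *\<^sub>R (LINT p : {0..t} \<times> UNIV | lborel. ?J T p))"
    by (intro continuous_intros continuous_on_integral_strip int)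
  then show "continuous_on {0..T} (\<lambda>t. LINT p : {0..t} \<times> UNIV | lborel. ?J t p)"
    by (rule continuous_on_eq) (simp only: set_lebesgue_integral_def fac integral_scaleR_right atLeastAtMost_iff)
qed

text \<open>The functional commutes with the Bochner integral of an integrable function; for a
  non-integrable one the integral is 0 by convention.\<close>

lemma cdot_integral_eq_0:
  assumes "\<And>p. cdot \<xi> (f p) = 0"
  shows "cdot \<xi> (\<integral>p. f p \<partial>M) = 0"
proof (cases "integrable M f")
  case True
  from integral_bounded_linear[OF bounded_linear_cdot this, of \<xi>] show ?thesis by (simp add: assms)
next
  case False
  then show ?thesis by (simp add: not_integrable_integral_eq cdot_def)
qed

lemma cdot_scaleR: "cdot \<xi> (r *\<^sub>R x) = r *\<^sub>R cdot \<xi> x"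
  by (rule bounded_linear.linear[OF bounded_linear_cdot, THEN linear_scale])

lemma cdot_diff: "cdot \<xi> (x - y) = cdot \<xi> x - cdot \<xi> y"
  by (rule bounded_linear.linear[OF bounded_linear_cdot, THEN linear_diff])

context gevrey_heat
begin

lemma zn_cong_AE: "(AE \<xi> in lborel. f \<xi> = g \<xi>) \<Longrightarrow> zn \<rho> f = zn \<rho> g"
  unfolding zn_def by (intro nn_integral_cong_AE) (auto elim!: eventually_mono)

lemma cdot_integrand: "cdot \<xi> (integrand v t \<xi> p) = 0"
  by (simp add: integrand_def cdot_scaleR bilin_def cdot_leray)

lemma cdot_duhamel_integrand: "cdot \<xi> (duhamel_integrand \<nu> v t \<xi> p) = 0"
  by (simp add: duhamel_integrand_def cdot_scaleR cdot_leray)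

lemma measurable_duhamel_integrand_lborel:
  assumes [measurable]: "case_prod v \<in> borel_measurable (borel \<Otimes>\<^sub>M borel)"
  shows "(\<lambda>p. indicat_real ({0..t} \<times> UNIV) p *\<^sub>R duhamel_integrand \<nu> v t \<xi> p) \<in> borel_measurable lborel"
proof -
  have "(\<lambda>p. indicat_real ({0..t} \<times> UNIV) p *\<^sub>R duhamel_integrand \<nu> v t \<xi> p) \<in> borel_measurable (borel \<Otimes>\<^sub>M borel)"
    unfolding indicator_strip duhamel_integrand_def by measurable
  then show ?thesis by (simp add: borel_prod)
qed

text \<open>For divergence-free fields the factor \<open>\<eta>\<^sub>j\<close> in the nonlinearity may be replaced by \<open>\<xi>\<^sub>j\<close>,
  since they differ by the divergence of \<open>v\<close> at \<open>\<xi> - \<eta>\<close>.\<close>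

lemma AE_duhamel_integrand_eq_integrand:
  assumes div: "AE \<xi> in lborel. \<forall>t\<in>{0..T}. cdot \<xi> (v t \<xi>) = 0" and "t \<le> T"
  shows "AE p in lborel. indicat_real ({0..t} \<times> UNIV) p *\<^sub>R duhamel_integrand \<nu> v t \<xi> p = integrand v t \<xi> p"
  using AE_lborel_snd[OF AE_lborel_diff[OF div, of \<xi>], where 'a = real]
proof eventually_elim
  case (elim p)
  show ?case
  proof (cases "fst p \<in> {0..t}")
    case True
    then have "cdot (\<xi> - snd p) (v (fst p) (\<xi> - snd p)) = 0" using elim \<open>t \<le> T\<close> by auto
    from leray_nonlin_integrand[of \<xi> "snd p" "v (fst p)", OF this] show ?thesis
      by (simp add: duhamel_integrand_def integrand_def)
  next
    case False
    then show ?thesis by (simp add: integrand_def indicator_strip)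
  qed
qed

lemma norm_integral_integrand_le:
  assumes [measurable]: "case_prod v \<in> borel_measurable (borel \<Otimes>\<^sub>M borel)"
    and int: "integrable lborel (integrand v t \<xi>)"
  shows "ennreal (norm (\<integral>p. integrand v t \<xi> p \<partial>lborel)) \<le> duh (\<lambda>s. conv (nrm v s) (nrm v s)) t \<xi>"
proof -
  have [measurable]: "case_prod (nrm v) \<in> borel_measurable (borel \<Otimes>\<^sub>M borel)" by measurable
  have "ennreal (norm (\<integral>p. integrand v t \<xi> p \<partial>lborel)) \<le> (\<integral>\<^sup>+p. ennreal (norm (integrand v t \<xi> p)) \<partial>lborel)"
    by (rule integral_norm_bound_ennreal[OF int])
  also have "\<dots> \<le> duh (\<lambda>s. conv (nrm v s) (nrm v s)) t \<xi>"
    by (subst duh_conv_eq) (measurable, intro nn_integral_mono norm_integrand_le(1))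
  finally show ?thesis .
qed

lemma norm_integral_integrand_diff_le_duh:
  assumes [measurable]: "case_prod v \<in> borel_measurable (borel \<Otimes>\<^sub>M borel)"
    "case_prod w \<in> borel_measurable (borel \<Otimes>\<^sub>M borel)"
    and int: "integrable lborel (integrand v t \<xi>)" "integrable lborel (integrand w t \<xi>)"
  defines "d \<equiv> nrm (\<lambda>s \<eta>. v s \<eta> - w s \<eta>)"
  shows "ennreal (norm ((\<integral>p. integrand v t \<xi> p \<partial>lborel) - (\<integral>p. integrand w t \<xi> p \<partial>lborel)))
    \<le> duh (\<lambda>s \<xi>. conv (d s) (nrm v s) \<xi> + conv (nrm w s) (d s) \<xi>) t \<xi>"
proof -
  have md: "case_prod d \<in> borel_measurable (borel \<Otimes>\<^sub>M borel)" unfolding d_def by measurable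
  have mv: "case_prod (nrm v) \<in> borel_measurable (borel \<Otimes>\<^sub>M borel)" by measurable
  have mw: "case_prod (nrm w) \<in> borel_measurable (borel \<Otimes>\<^sub>M borel)" by measurable
  note [measurable] = md mv mw
  let ?k = "\<lambda>m n p. kern t \<xi> (fst p) * (m (fst p) (\<xi> - snd p) * n (fst p) (snd p))"
  have mk: "?k m n \<in> borel_measurable lborel"
    if [measurable]: "case_prod m \<in> borel_measurable (borel \<Otimes>\<^sub>M borel)" "case_prod n \<in> borel_measurable (borel \<Otimes>\<^sub>M borel)" for m n
  proof -
    have "?k m n \<in> borel_measurable (borel \<Otimes>\<^sub>M borel)" by measurable
    then show ?thesis by (simp add: borel_prod)
  qed
  have "ennreal (norm ((\<integral>p. integrand v t \<xi> p \<partial>lborel) - (\<integral>p. integrand w t \<xi> p \<partial>lborel)))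
      \<le> (\<integral>\<^sup>+p. ennreal (norm (integrand v t \<xi> p - integrand w t \<xi> p)) \<partial>lborel)"
    by (rule norm_integral_integrand_diff_le) fact+
  also have "\<dots> \<le> (\<integral>\<^sup>+p. ?k d (nrm v) p + ?k (nrm w) d p \<partial>lborel)"
    unfolding distrib_left[symmetric] d_def by (intro nn_integral_mono norm_integrand_le(2))
  also have "\<dots> = duh (\<lambda>s. conv (d s) (nrm v s)) t \<xi> + duh (\<lambda>s. conv (nrm w s) (d s)) t \<xi>"
    unfolding duh_conv_eq[OF md mv] duh_conv_eq[OF mw md] by (intro nn_integral_add mk md mv mw)
  also have "\<dots> = duh (\<lambda>s \<xi>. conv (d s) (nrm v s) \<xi> + conv (nrm w s) (d s) \<xi>) t \<xi>"
    unfolding duh_def distrib_left by (rule nn_integral_add[symmetric]) measurable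
  finally show ?thesis .
qed

end

section \<open>Fixed points: regularity and uniqueness\<close>

context ns_data
begin

lemma fixpoint_measurable: "fixpoint T v \<Longrightarrow> case_prod v \<in> borel_measurable (borel \<Otimes>\<^sub>M borel)"
  by (simp add: fixpoint_def)

lemma measurable_nrm:
  assumes [measurable]: "case_prod v \<in> borel_measurable (borel \<Otimes>\<^sub>M borel)"
  shows "case_prod (nrm v) \<in> borel_measurable (borel \<Otimes>\<^sub>M borel)"
  by measurable

lemma fixpoint_div_free:
  assumes "fixpoint T v"
  shows "AE \<xi> in lborel. \<forall>t\<in>{0..T}. cdot \<xi> (v t \<xi>) = 0"
proof -
  have "AE \<xi> in lborel. \<forall>t\<in>{0..T}. integrable lborel (integrand v t \<xi>) \<and> v t \<xi> = picard_map v t \<xi>"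
    using assms by (simp add: fixpoint_def)
  then show ?thesis using u0_div_free
  proof eventually_elim
    case (elim \<xi>)
    have "cdot \<xi> (picard_map v t \<xi>) = 0" for t
      unfolding picard_map_def heat_flow_def cdot_diff cdot_scaleR
      by (subst cdot_integral_eq_0) (simp_all add: cdot_integrand elim)
    then show ?case using elim by simp
  qed
qed

lemma fixpoint_nrm_le:
  assumes "fixpoint T v"
  shows "AE \<xi> in lborel. \<forall>t\<in>{0..T}. nrm v t \<xi> \<le> nrm heat_flow t \<xi> + duh (\<lambda>s. conv (nrm v s) (nrm v s)) t \<xi>"
proof -
  have "AE \<xi> in lborel. \<forall>t\<in>{0..T}. integrable lborel (integrand v t \<xi>) \<and> v t \<xi> = picard_map v t \<xi>"
    using assms by (simp add: fixpoint_def)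
  then show ?thesis
  proof eventually_elim
    case (elim \<xi>)
    show ?case
    proof
      fix t assume "t \<in> {0..T}"
      with elim have v: "integrable lborel (integrand v t \<xi>)" "v t \<xi> = picard_map v t \<xi>" by auto
      have "norm (v t \<xi>) \<le> norm (heat_flow t \<xi>) + norm (\<integral>p. integrand v t \<xi> p \<partial>lborel)"
        unfolding v(2) picard_map_def by (rule norm_triangle_ineq4)
      from ennreal_leI[OF this]
      have "nrm v t \<xi> \<le> nrm heat_flow t \<xi> + ennreal (norm (\<integral>p. integrand v t \<xi> p \<partial>lborel))" by simp
      also have "\<dots> \<le> nrm heat_flow t \<xi> + duh (\<lambda>s. conv (nrm v s) (nrm v s)) t \<xi>"
        by (intro add_left_mono norm_integral_integrand_le fixpoint_measurable[OF assms] v)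
      finally show "nrm v t \<xi> \<le> nrm heat_flow t \<xi> + duh (\<lambda>s. conv (nrm v s) (nrm v s)) t \<xi>" .
    qed
  qed
qed

text \<open>The heat flow is bounded by the data and the Duhamel term through \<open>sconv\<close>,
  neither depending on t; this is the dominating function for continuity in Z^-1.\<close>

lemma fixpoint_dominated:
  assumes fp: "fixpoint T v"
  obtains D where "D \<in> borel_measurable borel" "zn (-1) D < \<infinity>"
    "AE \<xi> in lborel. \<forall>t\<in>{0..T}. nrm v t \<xi> \<le> D \<xi>"
proof
  note mv = measurable_nrm[OF fixpoint_measurable[OF fp]]
  note [measurable] = mv
  have q: "qn T (nrm v) < \<infinity>" using fp by (simp add: fixpoint_def)
  let ?D = "\<lambda>\<xi>. ennreal (norm (u0 \<xi>)) + ennreal (12 * norm \<xi>) * sconv T (nrm v) \<xi>"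
  show "?D \<in> borel_measurable borel" by measurable
  have "zn (-1) ?D = zn (-1) (\<lambda>\<xi>. ennreal (norm (u0 \<xi>))) + zn (-1) (\<lambda>\<xi>. ennreal (12 * norm \<xi>) * sconv T (nrm v) \<xi>)"
    by (rule zn_add) measurable
  then show "zn (-1) ?D < \<infinity>" using u0_finite zn_minus_1_sconv_finite[OF mv q] by simp
  show "AE \<xi> in lborel. \<forall>t\<in>{0..T}. nrm v t \<xi> \<le> ?D \<xi>"
    using fixpoint_nrm_le[OF fp]
  proof eventually_elim
    case (elim \<xi>)
    show ?case
    proof
      fix t assume t: "t \<in> {0..T}"
      with elim have "nrm v t \<xi> \<le> nrm heat_flow t \<xi> + duh (\<lambda>s. conv (nrm v s) (nrm v s)) t \<xi>" by blast
      also have "\<dots> \<le> ?D \<xi>"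
        using t by (intro add_mono nrm_heat_flow_le duh_le_sconv mv) auto
      finally show "nrm v t \<xi> \<le> ?D \<xi>" .
    qed
  qed
qed

lemma fixpoint_continuous:
  assumes fp: "fixpoint T v" and "T \<ge> 0"
  shows "AE \<xi> in lborel. continuous_on {0..T} (\<lambda>t. v t \<xi>)"
proof -
  have "AE \<xi> in lborel. \<forall>t\<in>{0..T}. integrable lborel (integrand v t \<xi>) \<and> v t \<xi> = picard_map v t \<xi>"
    using fp by (simp add: fixpoint_def)
  then show ?thesis
  proof eventually_elim
    case (elim \<xi>)
    let ?J = "\<lambda>t p. (exp (- \<nu> * (t - fst p) * (norm \<xi>)\<^sup>2) / (2 * pi) ^ 3)
       *\<^sub>R bilin \<xi> (v (fst p) (\<xi> - snd p)) (v (fst p) (snd p))"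
    have "integrable lborel (integrand v T \<xi>)" using elim \<open>T \<ge> 0\<close> by simp
    then have "set_integrable lborel ({0..T} \<times> UNIV) (?J T)"
      unfolding set_integrable_def integrand_def .
    from continuous_on_duhamel[OF this]
    have "continuous_on {0..T} (\<lambda>t. heat_flow t \<xi> - (LINT p : {0..t} \<times> UNIV | lborel. ?J t p))"
      unfolding heat_flow_def by (intro continuous_intros)
    then show ?case
      by (rule continuous_on_eq) (use elim in \<open>auto simp: picard_map_def integrand_def set_lebesgue_integral_def\<close>)
  qed
qed

lemma fixpoint_imp_mild_solution:
  assumes fp: "fixpoint T v" and "T \<ge> 0"
  shows "NS_mild_solution \<nu> a \<sigma> T u0 v"
  unfolding NS_mild_solution_def
proof (intro conjI ballI)
  note vmeas = fixpoint_measurable[OF fp]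
  note mv = measurable_nrm[OF vmeas]
  note [measurable] = vmeas mv
  have q: "qn T (nrm v) < \<infinity>" using fp by (simp add: fixpoint_def)
  from fixpoint_dominated[OF fp] obtain D where [measurable]: "D \<in> borel_measurable borel"
    and D: "zn (-1) D < \<infinity>" "AE \<xi> in lborel. \<forall>t\<in>{0..T}. nrm v t \<xi> \<le> D \<xi>" .
  have vt: "v t \<in> borel_measurable borel" for t by measurable
  show "v t \<in> Zspace (-1) a \<sigma>" if "t \<in> {0..T}" for t
  proof -
    have "zn (-1) (nrm v t) \<le> zn (-1) D"
      using D(2) that by (intro zn_mono_AE) (auto elim!: eventually_mono)
    then show ?thesis using D(1) vt by (simp add: Zspace_def Znorm_eq_zn order.strict_trans1)
  qed
  show "((\<lambda>s. Znorm (-1) a \<sigma> (\<lambda>\<xi>. v s \<xi> - v t \<xi>)) \<longlongrightarrow> 0) (at t within {0..T})" if t: "t \<in> {0..T}" for t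
    unfolding tendsto_at_iff_sequentially comp_def
  proof (intro allI impI)
    fix X assume X: "\<forall>i. X i \<in> {0..T} - {t}" "X \<longlonglongrightarrow> t"
    \<comment> \<open>Continuity in Z^-1: for almost every \<xi> the field is continuous in t, and
      twice \<open>D\<close> dominates the difference.\<close>
    have "(\<lambda>i. \<integral>\<^sup>+\<xi>. ennreal (zweight (-1) a \<sigma> \<xi> * norm (v (X i) \<xi> - v t \<xi>)) \<partial>lborel) \<longlonglongrightarrow> (\<integral>\<^sup>+(\<xi>::real^3). 0 \<partial>lborel)"
    proof (rule nn_integral_dominated_convergence)
      show "(\<lambda>\<xi>. 2 * (ennreal (zweight (-1) a \<sigma> \<xi>) * D \<xi>)) \<in> borel_measurable lborel" by measurable
      have "(\<integral>\<^sup>+\<xi>. 2 * (ennreal (zweight (-1) a \<sigma> \<xi>) * D \<xi>) \<partial>lborel) = 2 * zn (-1) D"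
        unfolding zn_def by (rule nn_integral_cmult) measurable
      then show "(\<integral>\<^sup>+\<xi>. 2 * (ennreal (zweight (-1) a \<sigma> \<xi>) * D \<xi>) \<partial>lborel) < \<infinity>"
        using D(1) by (simp add: ennreal_mult_less_top)
      show "AE \<xi> in lborel. ennreal (zweight (-1) a \<sigma> \<xi> * norm (v (X i) \<xi> - v t \<xi>))
          \<le> 2 * (ennreal (zweight (-1) a \<sigma> \<xi>) * D \<xi>)" for i
        using D(2)
      proof eventually_elim
        case (elim \<xi>)
        have "ennreal (norm (v (X i) \<xi> - v t \<xi>)) \<le> nrm v (X i) \<xi> + nrm v t \<xi>"
          using ennreal_leI[OF norm_triangle_ineq4[of "v (X i) \<xi>" "v t \<xi>"]] by simp
        also have "\<dots> \<le> D \<xi> + D \<xi>" using elim t X(1) by (intro add_mono) auto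
        finally have "ennreal (norm (v (X i) \<xi> - v t \<xi>)) \<le> 2 * D \<xi>" by (simp add: mult_2)
        then have "ennreal (zweight (-1) a \<sigma> \<xi>) * ennreal (norm (v (X i) \<xi> - v t \<xi>))
            \<le> ennreal (zweight (-1) a \<sigma> \<xi>) * (2 * D \<xi>)" by (rule mult_left_mono) simp
        then show ?case by (simp add: ennreal_mult mult.left_commute)
      qed
      show "AE \<xi> in lborel. (\<lambda>i. ennreal (zweight (-1) a \<sigma> \<xi> * norm (v (X i) \<xi> - v t \<xi>))) \<longlonglongrightarrow> 0"
        using fixpoint_continuous[OF fp \<open>T \<ge> 0\<close>]
      proof eventually_elim
        case (elim \<xi>)
        have "(\<lambda>i. v (X i) \<xi>) \<longlonglongrightarrow> v t \<xi>"
          using X t by (intro continuous_on_tendsto_compose[OF elim]) auto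
        then have "(\<lambda>i. ennreal (zweight (-1) a \<sigma> \<xi> * norm (v (X i) \<xi> - v t \<xi>))) \<longlonglongrightarrow>
            ennreal (zweight (-1) a \<sigma> \<xi> * norm (v t \<xi> - v t \<xi>))"
          by (intro tendsto_intros)
        then show ?case by simp
      qed
    qed measurable
    then show "(\<lambda>i. Znorm (-1) a \<sigma> (\<lambda>\<xi>. v (X i) \<xi> - v t \<xi>)) \<longlonglongrightarrow> 0"
      by (simp add: Znorm_def)
  qed
  show "(\<integral>\<^sup>+t\<in>{0..T}. Znorm 1 a \<sigma> (v t) \<partial>lborel) < \<infinity>"
  proof -
    let ?h = "\<lambda>s. conv (nrm v s) (nrm v s)"
    have "(\<integral>\<^sup>+t\<in>{0..T}. Znorm 1 a \<sigma> (v t) \<partial>lborel)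
       \<le> (\<integral>\<^sup>+t. zn 1 (nrm heat_flow t) * indicator {0..T} t + zn 1 (duh ?h t) * indicator {0..T} t \<partial>lborel)"
    proof (rule nn_integral_mono)
      fix t
      have "zn 1 (nrm v t) \<le> zn 1 (nrm heat_flow t) + zn 1 (duh ?h t)" if "t \<in> {0..T}"
      proof -
        have "zn 1 (nrm v t) \<le> zn 1 (\<lambda>\<xi>. nrm heat_flow t \<xi> + duh ?h t \<xi>)"
          using fixpoint_nrm_le[OF fp] that by (intro zn_mono_AE) (auto elim!: eventually_mono)
        also have "\<dots> = zn 1 (nrm heat_flow t) + zn 1 (duh ?h t)" by (rule zn_add) measurable
        finally show ?thesis .
      qed
      then show "Znorm 1 a \<sigma> (v t) * indicator {0..T} t \<le> zn 1 (nrm heat_flow t) * indicator {0..T} t + zn 1 (duh ?h t) * indicator {0..T} t"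
        by (simp add: Znorm_eq_zn split: split_indicator)
    qed
    also have "\<dots> = (\<integral>\<^sup>+t\<in>{0..T}. zn 1 (nrm heat_flow t) \<partial>lborel) + (\<integral>\<^sup>+t\<in>{0..T}. zn 1 (duh ?h t) \<partial>lborel)"
      by (rule nn_integral_add) measurable
    also have "\<dots> \<le> ennreal (1 / \<nu>) * zn (-1) (\<lambda>\<xi>. ennreal (norm (u0 \<xi>))) + ennreal (12 / \<nu>) * qn T (nrm v)"
    proof (intro add_mono nn_integral_zn_1_heat_flow_le order_trans[OF nn_integral_zn_1_duh_le])
      show "ennreal (12 / \<nu>) * (\<integral>\<^sup>+s\<in>{0..T}. zn0 (?h s) \<partial>lborel) \<le> ennreal (12 / \<nu>) * qn T (nrm v)"
        by (intro mult_left_mono nn_integral_zn0_conv_le_qn mv) simp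
    qed measurable
    also have "\<dots> < \<infinity>" using u0_finite q by (simp add: ennreal_mult_less_top)
    finally show ?thesis .
  qed
  show "AE \<xi> in lborel. set_integrable lborel ({0..t} \<times> UNIV) (duhamel_integrand \<nu> v t \<xi>) \<and>
        v t \<xi> = exp (- \<nu> * t * (norm \<xi>)\<^sup>2) *\<^sub>R u0 \<xi> - (LINT p : {0..t} \<times> UNIV | lborel. duhamel_integrand \<nu> v t \<xi> p)"
    if t: "t \<in> {0..T}" for t
  proof -
    have "AE \<xi> in lborel. \<forall>t\<in>{0..T}. integrable lborel (integrand v t \<xi>) \<and> v t \<xi> = picard_map v t \<xi>"
      using fp by (simp add: fixpoint_def)
    then show ?thesis
    proof eventually_elim
      case (elim \<xi>)
      \<comment> \<open>The fixed point solves the equation with \<xi> in place of \<eta>; as it is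
        divergence free, the original nonlinearity can be restored.\<close>
      have ae: "AE p in lborel. indicat_real ({0..t} \<times> UNIV) p *\<^sub>R duhamel_integrand \<nu> v t \<xi> p = integrand v t \<xi> p"
        using t by (intro AE_duhamel_integrand_eq_integrand[OF fixpoint_div_free[OF fp]]) simp
      note cong = measurable_duhamel_integrand_lborel[OF vmeas] measurable_integrand_lborel[OF vmeas] ae
      have "integrable lborel (integrand v t \<xi>)" "v t \<xi> = picard_map v t \<xi>" using elim t by auto
      then show ?case
        unfolding set_integrable_def set_lebesgue_integral_def integrable_cong_AE[OF cong] integral_cong_AE[OF cong]
        by (simp add: picard_map_def heat_flow_def)
    qed
  qed
qed

text \<open>The difference is bounded by a Duhamel term with source \<open>h\<close> linear in
  \<open>d\<close>, and the Z^0 norm of \<open>h\<close> is at most \<open>g\<close> times that of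
  \<open>d\<close>. The L^2 Z^0 estimate for that term is then the hypothesis \<open>est\<close> of
  \<open>gronwall_ennreal\<close>.\<close>

lemma fixpoint_unique:
  assumes v: "fixpoint T v" and w: "fixpoint T w" and t: "t \<in> {0..T}"
  shows "AE \<xi> in lborel. v t \<xi> = w t \<xi>"
proof -
  note vmeas = fixpoint_measurable[OF v] and wmeas = fixpoint_measurable[OF w]
  note [measurable] = vmeas wmeas
  define d where "d = nrm (\<lambda>s \<eta>. v s \<eta> - w s \<eta>)"
  define h where "h = (\<lambda>s \<xi>. conv (d s) (nrm v s) \<xi> + conv (nrm w s) (d s) \<xi>)"
  define g where "g s = zn0 (nrm v s) + zn0 (nrm w s)" for s
  have [measurable]: "case_prod d \<in> borel_measurable (borel \<Otimes>\<^sub>M borel)" unfolding d_def by measurable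
  have [measurable]: "case_prod (nrm v) \<in> borel_measurable (borel \<Otimes>\<^sub>M borel)" by measurable
  have [measurable]: "case_prod (nrm w) \<in> borel_measurable (borel \<Otimes>\<^sub>M borel)" by measurable
  have [measurable]: "case_prod h \<in> borel_measurable (borel \<Otimes>\<^sub>M borel)" unfolding h_def by measurable
  have [measurable]: "g \<in> borel_measurable borel" unfolding g_def by measurable
  have "AE \<xi> in lborel. \<forall>t\<in>{0..T}. integrable lborel (integrand v t \<xi>) \<and> v t \<xi> = picard_map v t \<xi>"
    "AE \<xi> in lborel. \<forall>t\<in>{0..T}. integrable lborel (integrand w t \<xi>) \<and> w t \<xi> = picard_map w t \<xi>"
    using v w by (simp_all add: fixpoint_def)
  then have d_le: "AE \<xi> in lborel. \<forall>t\<in>{0..T}. d t \<xi> \<le> duh h t \<xi>"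
  proof eventually_elim
    case (elim \<xi>)
    show ?case
    proof
      fix t assume "t \<in> {0..T}"
      with elim have *: "integrable lborel (integrand v t \<xi>)" "v t \<xi> = picard_map v t \<xi>"
        "integrable lborel (integrand w t \<xi>)" "w t \<xi> = picard_map w t \<xi>" by auto
      have "d t \<xi> = ennreal (norm ((\<integral>p. integrand v t \<xi> p \<partial>lborel) - (\<integral>p. integrand w t \<xi> p \<partial>lborel)))"
        unfolding d_def *(2,4) by (simp add: picard_map_def norm_minus_commute)
      also have "\<dots> \<le> duh h t \<xi>"
        unfolding h_def d_def by (rule norm_integral_integrand_diff_le_duh[OF vmeas wmeas *(1,3)])
      finally show "d t \<xi> \<le> duh h t \<xi>" .
    qed
  qed
  have zh: "zn0 (h s) \<le> g s * zn0 (d s)" for s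
  proof -
    have "zn0 (h s) = zn0 (conv (d s) (nrm v s)) + zn0 (conv (nrm w s) (d s))"
      unfolding h_def by (rule zn0_add) measurable
    also have "\<dots> \<le> zn0 (d s) * zn0 (nrm v s) + zn0 (nrm w s) * zn0 (d s)"
      by (intro add_mono zn0_conv_le) measurable
    also have "\<dots> = g s * zn0 (d s)" by (simp add: g_def distrib_left mult.commute[of _ "zn0 (d s)"])
    finally show ?thesis .
  qed
  have dg: "zn0 (d s) \<le> g s" for s
  proof -
    have "d s \<xi> \<le> nrm v s \<xi> + nrm w s \<xi>" for \<xi>
      using ennreal_leI[OF norm_triangle_ineq4[of "v s \<xi>" "w s \<xi>"]] by (simp add: d_def)
    then have "zn0 (d s) \<le> zn0 (\<lambda>\<xi>. nrm v s \<xi> + nrm w s \<xi>)" by (intro zn0_mono_AE) simp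
    also have "\<dots> = g s" unfolding g_def by (rule zn0_add) measurable
    finally show ?thesis .
  qed
  have hg: "(\<integral>\<^sup>+s\<in>{0..\<tau>}. zn0 (h s) \<partial>lborel) \<le> (\<integral>\<^sup>+s\<in>{0..\<tau>}. g s * zn0 (d s) \<partial>lborel)" for \<tau>
    by (intro nn_integral_mono mult_right_mono zh) simp
  have zero: "(\<integral>\<^sup>+t\<in>{0..T}. g t * zn0 (d t) \<partial>lborel) = 0"
  proof (rule gronwall_ennreal[where K = "144 / \<nu>"])
    have "(\<integral>\<^sup>+t\<in>{0..T}. (g t)\<^sup>2 \<partial>lborel) \<le> (\<integral>\<^sup>+t. 2 * ((zn0 (nrm v t))\<^sup>2 * indicator {0..T} t) + 2 * ((zn0 (nrm w t))\<^sup>2 * indicator {0..T} t) \<partial>lborel)"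
      unfolding g_def using power2_add_le_ennreal
      by (intro nn_integral_mono) (auto split: split_indicator)
    also have "\<dots> = 2 * qn T (nrm v) + 2 * qn T (nrm w)"
      unfolding qn_def by (simp add: nn_integral_add nn_integral_cmult)
    also have "\<dots> < \<infinity>" using v w by (simp add: fixpoint_def ennreal_mult_less_top)
    finally show "(\<integral>\<^sup>+t\<in>{0..T}. (g t)\<^sup>2 \<partial>lborel) < \<infinity>" .
    fix \<tau> assume \<tau>: "0 \<le> \<tau>" "\<tau> \<le> T"
    have "zn0 (d s) \<le> zn0 (duh h s)" if "s \<in> {0..\<tau>}" for s
      using d_le that \<tau> by (intro zn0_mono_AE) (auto elim!: eventually_mono)
    then have "(\<integral>\<^sup>+t\<in>{0..\<tau>}. (zn0 (d t))\<^sup>2 \<partial>lborel) \<le> (\<integral>\<^sup>+t\<in>{0..\<tau>}. (zn0 (duh h t))\<^sup>2 \<partial>lborel)"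
      by (intro nn_integral_mono) (auto split: split_indicator intro!: power_mono)
    also have "\<dots> \<le> ennreal (144 / \<nu>) * (\<integral>\<^sup>+s\<in>{0..\<tau>}. zn0 (h s) \<partial>lborel)\<^sup>2"
      by (rule nn_integral_zn0_duh_power2_le) measurable
    also have "\<dots> \<le> ennreal (144 / \<nu>) * (\<integral>\<^sup>+t\<in>{0..\<tau>}. g t * zn0 (d t) \<partial>lborel)\<^sup>2"
      by (intro mult_left_mono power_mono hg) simp_all
    finally show "(\<integral>\<^sup>+t\<in>{0..\<tau>}. (zn0 (d t))\<^sup>2 \<partial>lborel) \<le> ennreal (144 / \<nu>) * (\<integral>\<^sup>+t\<in>{0..\<tau>}. g t * zn0 (d t) \<partial>lborel)\<^sup>2" .
  qed (use t nu_pos dg in auto)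
  \<comment> \<open>The vanishing time integral says nothing about an individual t; the Z^-1 bound
    of the Duhamel term gives equality at each t.\<close>
  have "zn (-1) (d t) \<le> zn (-1) (duh h t)"
    using d_le t by (intro zn_mono_AE) (auto elim!: eventually_mono)
  also have "\<dots> \<le> 12 * (\<integral>\<^sup>+s\<in>{0..t}. zn0 (h s) \<partial>lborel)" by (rule zn_minus_1_duh_le) measurable
  also have "\<dots> \<le> 12 * (\<integral>\<^sup>+s\<in>{0..t}. g s * zn0 (d s) \<partial>lborel)" by (intro mult_left_mono hg) simp
  also have "\<dots> \<le> 12 * (\<integral>\<^sup>+s\<in>{0..T}. g s * zn0 (d s) \<partial>lborel)"
    using t by (intro mult_left_mono nn_integral_mono) (auto split: split_indicator)
  finally have "zn (-1) (d t) = 0" unfolding zero by simp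
  then have "AE \<xi> in lborel. ennreal (zweight (-1) a \<sigma> \<xi>) * d t \<xi> = 0"
    unfolding zn_def by (subst (asm) nn_integral_0_iff_AE) auto
  \<comment> \<open>The weight vanishes at the origin, so that point is removed before the weight is
    cancelled.\<close>
  then show ?thesis using AE_lborel_singleton[of "0 :: real^3"]
  proof eventually_elim
    case (elim \<xi>)
    then have "zweight (-1) a \<sigma> \<xi> > 0" by (simp add: zweight_def)
    then show ?case using elim(1) by (auto simp: d_def ennreal_eq_0_iff)
  qed
qed

end

section \<open>Mild solutions and their jointly measurable modifications\<close>

lemma tendsto_floor_multiple:
  fixes t :: real
  shows "(\<lambda>n. of_int \<lfloor>real (Suc n) * t\<rfloor> / real (Suc n)) \<longlonglongrightarrow> t"
proof (rule tendsto_sandwich)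
  have "(\<lambda>n. t - 1 / real (Suc n)) \<longlonglongrightarrow> t - 0"
    by (intro tendsto_intros LIMSEQ_Suc[OF lim_const_over_n[of 1]])
  then show "(\<lambda>n. t - 1 / real (Suc n)) \<longlonglongrightarrow> t" by simp
  show "\<forall>\<^sub>F n in sequentially. t - 1 / real (Suc n) \<le> of_int \<lfloor>real (Suc n) * t\<rfloor> / real (Suc n)"
  proof (intro always_eventually allI)
    fix n
    have "real (Suc n) * t - 1 \<le> of_int \<lfloor>real (Suc n) * t\<rfloor>" by linarith
    then have "(real (Suc n) * t - 1) / real (Suc n) \<le> of_int \<lfloor>real (Suc n) * t\<rfloor> / real (Suc n)"
      by (rule divide_right_mono) simp
    then show "t - 1 / real (Suc n) \<le> of_int \<lfloor>real (Suc n) * t\<rfloor> / real (Suc n)"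
      by (simp only: diff_divide_distrib) (simp del: of_nat_Suc)
  qed
  show "\<forall>\<^sub>F n in sequentially. of_int \<lfloor>real (Suc n) * t\<rfloor> / real (Suc n) \<le> t"
  proof (intro always_eventually allI)
    fix n
    have "of_int \<lfloor>real (Suc n) * t\<rfloor> \<le> real (Suc n) * t" by (rule of_int_floor_le)
    then show "of_int \<lfloor>real (Suc n) * t\<rfloor> / real (Suc n) \<le> t"
      by (simp add: field_simps)
  qed
qed simp

context ns_data
begin

text \<open>Continuity is expressed only through \<open>Znorm\<close> of differences, so boundedness
  is derived by sequential compactness: times with norms above n accumulate at some l, near which
  the norm is at most 1 plus its value at l.\<close>

lemma mild_solution_Znorm_bounded:
  assumes sol: "NS_mild_solution \<nu> a \<sigma> T u0 w"
  obtains B where "B < \<infinity>" "\<And>t. t \<in> {0..T} \<Longrightarrow> Znorm (-1) a \<sigma> (w t) \<le> B"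
proof -
  have wZ: "w t \<in> borel_measurable borel" "Znorm (-1) a \<sigma> (w t) < \<infinity>" if "t \<in> {0..T}" for t
    using sol that by (auto simp: NS_mild_solution_def Zspace_def)
  have "\<exists>n::nat. \<forall>t\<in>{0..T}. Znorm (-1) a \<sigma> (w t) \<le> of_nat n"
  proof (rule ccontr)
    assume "\<not> ?thesis"
    then have "\<forall>n::nat. \<exists>t\<in>{0..T}. of_nat n < Znorm (-1) a \<sigma> (w t)" by (auto simp: not_le)
    then obtain t where t: "\<And>n::nat. t n \<in> {0..T}" "\<And>n. of_nat n < Znorm (-1) a \<sigma> (w (t n))" by metis
    have "compact {0..T}" by simp
    then obtain l r where lr: "l \<in> {0..T}" "strict_mono r" "(t \<circ> r) \<longlonglongrightarrow> l"
      unfolding compact_def using t(1) by metis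
    have "((\<lambda>s. Znorm (-1) a \<sigma> (\<lambda>\<xi>. w s \<xi> - w l \<xi>)) \<longlongrightarrow> 0) (at l within {0..T})"
      using sol lr(1) by (simp add: NS_mild_solution_def)
    then have "\<forall>\<^sub>F s in at l within {0..T}. Znorm (-1) a \<sigma> (\<lambda>\<xi>. w s \<xi> - w l \<xi>) < 1"
      by (rule order_tendstoD) simp
    then obtain e where e: "e > 0" "\<And>s. s \<in> {0..T} \<Longrightarrow> s \<noteq> l \<Longrightarrow> dist s l < e \<Longrightarrow> Znorm (-1) a \<sigma> (\<lambda>\<xi>. w s \<xi> - w l \<xi>) < 1"
      unfolding eventually_at by blast
    \<comment> \<open>The limit at l ignores s = l itself, which therefore forms a separate
      case.\<close>
    have near: "Znorm (-1) a \<sigma> (w s) \<le> 1 + Znorm (-1) a \<sigma> (w l)" if s: "s \<in> {0..T}" "dist s l < e" for s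
    proof (cases "s = l")
      case False
      note [measurable] = wZ(1)[OF s(1)] wZ(1)[OF lr(1)]
      have "Znorm (-1) a \<sigma> (w s) \<le> zn (-1) (\<lambda>\<xi>. ennreal (norm (w s \<xi> - w l \<xi>)) + ennreal (norm (w l \<xi>)))"
        unfolding Znorm_eq_zn by (intro zn_mono_AE AE_I2 ennreal_norm_le_diff_add)
      also have "\<dots> = Znorm (-1) a \<sigma> (\<lambda>\<xi>. w s \<xi> - w l \<xi>) + Znorm (-1) a \<sigma> (w l)"
        unfolding Znorm_eq_zn by (rule zn_add) measurable
      also have "\<dots> \<le> 1 + Znorm (-1) a \<sigma> (w l)"
        using e(2)[OF s(1) False s(2)] by (intro add_right_mono) simp
      finally show ?thesis .
    qed (simp add: add_increasing)
    obtain b where b: "Znorm (-1) a \<sigma> (w l) = ennreal b" "b \<ge> 0"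
      using wZ(2)[OF lr(1)] by (cases "Znorm (-1) a \<sigma> (w l)") auto
    have "\<forall>\<^sub>F n in sequentially. dist ((t \<circ> r) n) l < e"
      using lr(3) e(1) by (rule tendstoD)
    moreover have "\<forall>\<^sub>F n in sequentially. real n > 1 + b"
      using eventually_gt_at_top[of "nat \<lceil>1 + b\<rceil>"] by eventually_elim linarith
    ultimately have "\<forall>\<^sub>F n in sequentially. dist ((t \<circ> r) n) l < e \<and> real n > 1 + b"
      by (rule eventually_conj)
    then obtain n where n: "dist (t (r n)) l < e" "real n > 1 + b"
      by (auto simp: eventually_sequentially)
    have "of_nat (r n) < Znorm (-1) a \<sigma> (w (t (r n)))" by (rule t)
    also have "\<dots> \<le> 1 + ennreal b" using near[OF t(1) n(1)] b by simp
    also have "\<dots> = ennreal (1 + b)" using b by simp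
    finally have "real (r n) < 1 + b"
      by (simp only: ennreal_of_nat_eq_real_of_nat ennreal_less_iff of_nat_0_le_iff)
    then show False using n(2) seq_suble[OF lr(2), of n] by linarith
  qed
  then show ?thesis using that by (metis infinity_ennreal_def of_nat_less_top)
qed

text \<open>A mild solution need not be jointly measurable in \<open>(t, \<xi>)\<close>, so Tonelli does not apply to it
  directly. Its Duhamel formula is continuous in \<open>t\<close> for almost every \<open>\<xi>\<close>, so step functions in time
  converge to a jointly Borel modification.\<close>

lemma mild_solution_imp_fixpoint:
  assumes sol: "NS_mild_solution \<nu> a \<sigma> T u0 w" and "T \<ge> 0"
  obtains v where "fixpoint T v" "\<And>t. t \<in> {0..T} \<Longrightarrow> AE \<xi> in lborel. w t \<xi> = v t \<xi>"
proof -
  have wm: "w t \<in> borel_measurable borel" if "t \<in> {0..T}" for t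
    using sol that by (auto simp: NS_mild_solution_def Zspace_def)
  define R where "R t \<xi> = heat_flow t \<xi> - (LINT p : {0..t} \<times> UNIV | lborel. duhamel_integrand \<nu> w t \<xi> p)" for t \<xi>
  have eq: "AE \<xi> in lborel. set_integrable lborel ({0..t} \<times> UNIV) (duhamel_integrand \<nu> w t \<xi>) \<and> w t \<xi> = R t \<xi>"
    if "t \<in> {0..T}" for t
    using sol that by (simp add: NS_mild_solution_def R_def heat_flow_def)
  \<comment> \<open>Sample times are clamped to {0..T}, where measurability of \<open>w\<close> in
    \<xi> is guaranteed.\<close>
  define q :: "nat \<Rightarrow> int \<Rightarrow> real" where "q n k = max 0 (min T (of_int k / real (Suc n)))" for n k
  have q_mem: "q n k \<in> {0..T}" for n k using \<open>T \<ge> 0\<close> by (auto simp: q_def)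
  define v where "v t \<xi> = lim (\<lambda>n. w (q n \<lfloor>real (Suc n) * t\<rfloor>) \<xi>)" for t \<xi>
  have step: "(\<lambda>x. w (q n \<lfloor>real (Suc n) * fst x\<rfloor>) (snd x)) \<in> borel_measurable (borel \<Otimes>\<^sub>M borel)" for n
  proof (rule measurable_compose_countable[where f = "\<lambda>k x. w (q n k) (snd x)"])
    show "(\<lambda>x. w (q n k) (snd x)) \<in> borel_measurable (borel \<Otimes>\<^sub>M borel)" for k
      by (rule measurable_compose[OF measurable_snd wm[OF q_mem]])
    show "(\<lambda>x. \<lfloor>real (Suc n) * fst x\<rfloor>) \<in> measurable (borel \<Otimes>\<^sub>M borel) (count_space UNIV)"
      by measurable
  qed
  have vmeas: "case_prod v \<in> borel_measurable (borel \<Otimes>\<^sub>M borel)"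
    unfolding v_def case_prod_beta' by (intro borel_measurable_lim_metric step)
  have Tint: "AE \<xi> in lborel. set_integrable lborel ({0..T} \<times> UNIV) (duhamel_integrand \<nu> w T \<xi>)"
    using eq[of T] \<open>T \<ge> 0\<close> by (auto elim: eventually_mono)
  \<comment> \<open>Only countably many sample times occur, so one null set of frequencies serves
    them all.\<close>
  have "AE \<xi> in lborel. \<forall>n k. w (q n k) \<xi> = R (q n k) \<xi>"
    unfolding AE_all_countable using eq[OF q_mem] by (auto elim: eventually_mono)
  then have vR: "AE \<xi> in lborel. \<forall>t\<in>{0..T}. v t \<xi> = R t \<xi>"
    using Tint
  proof eventually_elim
    case (elim \<xi>)
    have "continuous_on {0..T} (\<lambda>t. LINT p : {0..t} \<times> UNIV | lborel. duhamel_integrand \<nu> w t \<xi> p)"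
      using elim(2) unfolding duhamel_integrand_def by (rule continuous_on_duhamel)
    then have cont: "continuous_on {0..T} (\<lambda>t. R t \<xi>)"
      unfolding R_def heat_flow_def by (intro continuous_intros)
    show ?case
    proof
      fix t assume t: "t \<in> {0..T}"
      have "(\<lambda>n. q n \<lfloor>real (Suc n) * t\<rfloor>) \<longlonglongrightarrow> max 0 (min T t)"
        unfolding q_def by (intro tendsto_max tendsto_min tendsto_const tendsto_floor_multiple)
      then have "(\<lambda>n. q n \<lfloor>real (Suc n) * t\<rfloor>) \<longlonglongrightarrow> t" using t by simp
      then have "(\<lambda>n. R (q n \<lfloor>real (Suc n) * t\<rfloor>) \<xi>) \<longlonglongrightarrow> R t \<xi>"
        using t q_mem by (intro continuous_on_tendsto_compose[OF cont]) auto
      then show "v t \<xi> = R t \<xi>" unfolding v_def using elim(1) by (simp add: limI)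
    qed
  qed
  have wv: "AE \<xi> in lborel. w t \<xi> = v t \<xi>" if "t \<in> {0..T}" for t
    using eq[OF that] vR by eventually_elim (use that in auto)
  have "AE \<xi> in lborel. \<forall>t\<in>{0..T}. cdot \<xi> (v t \<xi>) = 0"
    using vR u0_div_free
  proof eventually_elim
    case (elim \<xi>)
    have "cdot \<xi> (R t \<xi>) = 0" for t
      unfolding R_def heat_flow_def cdot_diff cdot_scaleR set_lebesgue_integral_def
      by (subst cdot_integral_eq_0) (simp_all add: cdot_scaleR cdot_duhamel_integrand elim)
    then show ?case using elim by simp
  qed
  note div = this
  have ae_eq: "AE p in lborel. indicat_real ({0..T} \<times> UNIV) p *\<^sub>R duhamel_integrand \<nu> w T \<xi> p
      = indicat_real ({0..T} \<times> UNIV) p *\<^sub>R duhamel_integrand \<nu> v T \<xi> p"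
    if int: "set_integrable lborel ({0..T} \<times> UNIV) (duhamel_integrand \<nu> w T \<xi>)" for \<xi>
  proof (rule AE_lborel_pairI)
    \<comment> \<open>For this fixed \<xi>, joint measurability of the integrand of \<open>w\<close>
      in (s, \<eta>) is part of its integrability; it permits the slicewise comparison although
      \<open>w\<close> itself may fail to be jointly measurable.\<close>
    have "(\<lambda>p. indicat_real ({0..T} \<times> UNIV) p *\<^sub>R duhamel_integrand \<nu> w T \<xi> p) \<in> borel_measurable lborel"
      using int unfolding set_integrable_def by (rule borel_measurable_integrable)
    with measurable_duhamel_integrand_lborel[OF vmeas, of T \<xi>]
    have [measurable]: "(\<lambda>p. indicat_real ({0..T} \<times> UNIV) p *\<^sub>R duhamel_integrand \<nu> w T \<xi> p) \<in> borel_measurable (borel \<Otimes>\<^sub>M borel)"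
      "(\<lambda>p. indicat_real ({0..T} \<times> UNIV) p *\<^sub>R duhamel_integrand \<nu> v T \<xi> p) \<in> borel_measurable (borel \<Otimes>\<^sub>M borel)"
      by (simp_all add: borel_prod)
    show "Measurable.pred (borel \<Otimes>\<^sub>M borel) (\<lambda>p. indicat_real ({0..T} \<times> UNIV) p *\<^sub>R duhamel_integrand \<nu> w T \<xi> p
      = indicat_real ({0..T} \<times> UNIV) p *\<^sub>R duhamel_integrand \<nu> v T \<xi> p)"
      by measurable
    show "AE s in lborel. AE \<eta> in lborel. indicat_real ({0..T} \<times> UNIV) (s, \<eta>) *\<^sub>R duhamel_integrand \<nu> w T \<xi> (s, \<eta>)
      = indicat_real ({0..T} \<times> UNIV) (s, \<eta>) *\<^sub>R duhamel_integrand \<nu> v T \<xi> (s, \<eta>)"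
    proof (rule AE_I2)
      fix s
      show "AE \<eta> in lborel. indicat_real ({0..T} \<times> UNIV) (s, \<eta>) *\<^sub>R duhamel_integrand \<nu> w T \<xi> (s, \<eta>)
        = indicat_real ({0..T} \<times> UNIV) (s, \<eta>) *\<^sub>R duhamel_integrand \<nu> v T \<xi> (s, \<eta>)"
      proof (cases "s \<in> {0..T}")
        case True
        from wv[OF True] AE_lborel_diff[OF wv[OF True], of \<xi>] show ?thesis
          by eventually_elim (simp add: duhamel_integrand_def nonlin_integrand_def)
      qed (simp add: indicator_strip)
    qed
  qed
  have "AE \<xi> in lborel. \<forall>t\<in>{0..T}. integrable lborel (integrand v t \<xi>) \<and> v t \<xi> = picard_map v t \<xi>"
    using vR Tint
  proof (eventually_elim, intro ballI)
    fix \<xi> t assume vR': "\<forall>t\<in>{0..T}. v t \<xi> = R t \<xi>" and t: "t \<in> {0..T}"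
      and int: "set_integrable lborel ({0..T} \<times> UNIV) (duhamel_integrand \<nu> w T \<xi>)"
    let ?w = "\<lambda>p. indicat_real ({0..t} \<times> UNIV) p *\<^sub>R duhamel_integrand \<nu> w t \<xi> p"
    have tT: "t \<le> T" using t by simp
    have int_w: "integrable lborel ?w"
      using set_integrable_duhamel[OF int[unfolded duhamel_integrand_def] tT]
      unfolding set_integrable_def duhamel_integrand_def .
    have ae: "AE p in lborel. ?w p = integrand v t \<xi> p"
      using ae_eq[OF int] AE_duhamel_integrand_eq_integrand[OF div tT, of \<xi>]
    proof eventually_elim
      case (elim p)
      \<comment> \<open>\<open>duhamel_factor\<close> carries the equality of the integrands from
        the final time T to time t, on the same null set.\<close>
      from elim(1) have "?w p = indicat_real ({0..t} \<times> UNIV) p *\<^sub>R duhamel_integrand \<nu> v t \<xi> p"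
        unfolding duhamel_integrand_def
        by (simp only: duhamel_factor[OF tT, where N = "\<lambda>p. leray \<xi> (nonlin_integrand (w (fst p)) \<xi> (snd p))"]
            duhamel_factor[OF tT, where N = "\<lambda>p. leray \<xi> (nonlin_integrand (v (fst p)) \<xi> (snd p))"])
      with elim(2) show ?case by simp
    qed
    note cong = borel_measurable_integrable[OF int_w] measurable_integrand_lborel[OF vmeas] ae
    have "integrable lborel (integrand v t \<xi>)"
      using int_w integrable_cong_AE[OF cong] by simp
    moreover have "v t \<xi> = picard_map v t \<xi>"
      using vR' t integral_cong_AE[OF cong] by (simp add: R_def picard_map_def set_lebesgue_integral_def)
    ultimately show "integrable lborel (integrand v t \<xi>) \<and> v t \<xi> = picard_map v t \<xi>" ..
  qed
  moreover have "qn T (nrm v) < \<infinity>"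
  proof -
    have Zeq: "zn \<rho> (nrm v t) = Znorm \<rho> a \<sigma> (w t)" if "t \<in> {0..T}" for t \<rho>
      unfolding Znorm_eq_zn using wv[OF that] by (intro zn_cong_AE) (auto elim!: eventually_mono)
    obtain B where B: "B < \<infinity>" "\<And>t. t \<in> {0..T} \<Longrightarrow> Znorm (-1) a \<sigma> (w t) \<le> B"
      using mild_solution_Znorm_bounded[OF sol] by blast
    \<comment> \<open>Interpolation between the two norm conditions of a mild solution: Z^-1
      uniformly in time and Z^1 integrated in time.\<close>
    have "qn T (nrm v) \<le> B * (\<integral>\<^sup>+t\<in>{0..T}. zn 1 (nrm v t) \<partial>lborel)"
      unfolding qn_def
      by (rule nn_integral_zn0_power2_le[OF measurable_nrm[OF vmeas]]) (simp_all add: Zeq B(2))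
    also have "(\<integral>\<^sup>+t\<in>{0..T}. zn 1 (nrm v t) \<partial>lborel) = (\<integral>\<^sup>+t\<in>{0..T}. Znorm 1 a \<sigma> (w t) \<partial>lborel)"
      by (intro nn_integral_cong) (simp add: Zeq split: split_indicator)
    also have "B * \<dots> < \<infinity>"
      using sol B(1) by (simp add: NS_mild_solution_def ennreal_mult_less_top)
    finally show ?thesis .
  qed
  ultimately have "fixpoint T v" using vmeas by (simp add: fixpoint_def)
  then show ?thesis using wv that by blast
qed

end

theorem theorem3p1:
  fixes a \<sigma> \<nu> :: real and u0 :: "real^3 \<Rightarrow> complex^3"
  assumes "a > 0" and "\<sigma> > 1" and "\<nu> > 0"
    and "u0 \<in> Zspace (-1) a \<sigma>"
    and "AE \<xi> in lborel. (\<Sum>j\<in>UNIV. complex_of_real (\<xi> $ j) * u0 \<xi> $ j) = 0"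
  shows "\<exists>T>0. \<exists>v. NS_mild_solution \<nu> a \<sigma> T u0 v \<and>
           (\<forall>w. NS_mild_solution \<nu> a \<sigma> T u0 w \<longrightarrow>
                 (\<forall>t\<in>{0..T}. AE \<xi> in lborel. w t \<xi> = v t \<xi>))"
proof -
  interpret gevrey_heat a \<sigma> \<nu> using assms by unfold_locales
  interpret ns_data a \<sigma> \<nu> u0
    using assms by unfold_locales (simp_all add: Zspace_def Znorm_eq_zn cdot_def)
  obtain T v where T: "T > 0" and v: "fixpoint T v" using fixpoint_exists by blast
  have "AE \<xi> in lborel. w t \<xi> = v t \<xi>" if w: "NS_mild_solution \<nu> a \<sigma> T u0 w" and t: "t \<in> {0..T}" for w t
  proof -
    obtain w' where w': "fixpoint T w'" "AE \<xi> in lborel. w t \<xi> = w' t \<xi>"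
      using mild_solution_imp_fixpoint[OF w] T t by (metis less_imp_le)
    from w'(2) fixpoint_unique[OF w'(1) v t] show ?thesis by eventually_elim simp
  qed
  then show ?thesis using fixpoint_imp_mild_solution[OF v] T by (meson less_imp_le)
qed

end
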